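(* Consider the power system model with vector field $f$, inputs $u$ governed by controller dynamics $g_u:\mathbb{R}_{>0}\times\mathbb{R}^{n_x}\times\mathbb{R}^{n_u}\times\mathbb{R}\to\mathbb{R}^{n_u}$, static load current $i_l(v)$, residual $\rho$ and set $\mathcal{S}=\{(x,u,\omega_0)\in\mathbb{R}^{n_x}\times\mathbb{R}^{n_u}\times\mathbb{R} : \rho(x,u,\omega_0)=0\}$, all as defined in the context. The set $\mathcal{S}$ is invariant with respect to the dynamics $$\tfrac{d}{dt}(x,u)=\big(f(x,u),\,g_u(t,x,u,\omega_0)\big)\qquad(\omega_0\text{ constant})$$ if and only if the following two conditions hold: (i) the control inputs are constant on $\mathcal{S}$, i.e. $g_u(t,x,u,\omega_0)=0$ for all $(x,u,\omega_0)\in\mathcal{S}$ (and all $t$); (ii) the load current satisfies $\tfrac{d}{dt} i_l(v)=\omega_0 J_v\, i_l(v)$ for all $(x,u,\omega_0)\in\mathcal{S}$, where $\tfrac{d}{dt}$ is the time derivative along the dynamics.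
   Context: Notation. $(a,b)$ denotes stacked column vectors; $\mathrm{diag}$ denotes (block-)diagonal matrices; $\otimes$ is the Kronecker product. $\mathrm{R}(\theta)=\begin{bmatrix}\cos\theta&-\sin\theta\\ \sin\theta&\cos\theta\end{bmatrix}$, $j=\mathrm{R}(\pi/2)$, $\mathsf{J}=\mathrm{diag}(j,0_{3\times3})\in\mathbb{R}^{5\times5}$. Sizes. There are $n_g$ generators, $n_v\ge n_g$ buses (generator $k$ is attached to bus $k$), $n_l=n_v-n_g$, and $n_t$ transmission lines. $E\in\{-1,0,1\}^{n_v\times n_t}$ is the oriented incidence matrix of the network graph (buses are nodes, lines are edges) and $\mathcal{E}=E\otimes I_2$. State and input. $x=(\theta,\omega,i,v,i_T)$, $n_x=7n_g+2n_v+2n_t$, with rotor angles $\theta_k$, rotor speeds $\omega_k\in\mathbb{R}$, machine currents $i_k=(i_{s,k},i_{f,k},i_{d,k},i_{q,k})\in\mathbb{R}^5$ ($i_{s,k}\in\mathbb{R}^2$ stator current; $i_{f,k},i_{d,k},i_{q,k}\in\mathbb{R}$ excitation and damper currents), $k=1,\dots,n_g$; bus voltages $v_k\in\mathbb{R}^2$, $k=1,\dots,n_v$; line currents $i_{T,k}\in\mathbb{R}^2$, $k=1,\dots,n_t$. The input is $u=(\tau_m,v_f)\in\mathbb{R}^{n_u}$, $n_u=2n_g$ (mechanical torques, excitation voltages). Parameters. $M=\mathrm{diag}(m_k)$, $D=\mathrm{diag}(d_k)$, $m_k,d_k>0$; $R=\mathrm{diag}(R_1,\dots,R_{n_g})$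 with $R_k=\mathrm{diag}(r_{s,k},r_{s,k},r_{f,k},r_{d,k},r_{q,k})$, all entries positive; $C=\mathrm{diag}(c_kI_2)$, $R_T=\mathrm{diag}(r_{T,k}I_2)$, $L_T=\mathrm{diag}(l_{T,k}I_2)$, $c_k,r_{T,k},l_{T,k}>0$. $L(\theta)=\mathrm{diag}(L_1(\theta_1),\dots,L_{n_g}(\theta_{n_g}))$ with $$L_k(\theta_k)=\begin{bmatrix}L_{s,k}(\theta_k)&L_{m,k}(\theta_k)\\L_{m,k}(\theta_k)^\top&L_{r,k}\end{bmatrix},\quad L_{r,k}=\begin{bmatrix}l_{f,k}&l_{fd,k}&0\\l_{fd,k}&l_{d,k}&0\\0&0&l_{q,k}\end{bmatrix},$$ $L_{s,k}(\theta_k)=l_{s,k}I_2+\mathrm{R}(2\theta_k)\,\mathrm{diag}(l_{sa,k},-l_{sa,k})$, $L_{m,k}(\theta_k)=\mathrm{R}(\theta_k)\begin{bmatrix}l_{sf,k}&l_{sd,k}&0\\0&0&-l_{sq,k}\end{bmatrix}$, with $l_{sa,k}\ge0$, all other inductance constants positive, and $L_k(\theta_k)$ invertible. Torque and induced voltage: $\tau_{e,k}=\tfrac12 i_k^\top(L_k(\theta_k)\mathsf{J}+\mathsf{J}^\top L_k(\theta_k))i_k$ and $v_{\mathrm{ind},k}=\omega_k(L_k(\theta_k)\mathsf{J}^\top+\mathsf{J}L_k(\theta_k))i_k$; $\tau_e,v_{\mathrm{ind}}$ are the stacked vectors. Loads. $i_l(v)=(i_{l,1}(v_1),\dots,i_{l,n_v}(v_{n_v}))$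 with (differentiable) $i_{l,k}:\mathbb{R}^2\to\mathbb{R}^2$ satisfying $i_{l,k}(v_k)^\top v_k\ge0$ and $i_{l,k}(0)=0$. Selection matrices: $\mathcal{I}_f=I_{n_g}\otimes(0,0,1,0,0)$ (column), $\mathcal{I}_s=I_{n_g}\otimes\begin{bmatrix}I_2\\0_{3\times2}\end{bmatrix}$, $\mathcal{I}_v^\top=[\mathcal{I}_s\;\;0_{5n_g\times2n_l}]$. $J_v=I_{n_v}\otimes j$, $J_T=I_{n_t}\otimes j$, $\mathcal{J}_g=I_{n_g}\otimes\mathsf{J}$. Power system dynamics: $\tfrac{d}{dt}x=f(x,u)$ with $\mathcal{M}(x)=\mathrm{diag}(I_{n_g},M,L(\theta),C,L_T)$ and $$f(x,u)=\mathcal{M}(x)^{-1}\begin{bmatrix}\omega\\-D\omega-\tau_e+\tau_m\\-Ri+\mathcal{I}_v^\top v+\mathcal{I}_fv_f-v_{\mathrm{ind}}\\-\mathcal{I}_vi-\mathcal{E}i_T-i_l(v)\\-R_Ti_T+\mathcal{E}^\top v\end{bmatrix}.$$ Synchronous steady-state dynamics at frequency $\omega_0\in\mathbb{R}$: $\tfrac{d}{dt}x=f_d(x,\omega_0)=(\omega_0\mathbf{1}_{n_g},0,\omega_0\mathcal{J}_gi,\omega_0J_vv,\omega_0J_Ti_T)$. Residual: $\rho(x,u,\omega_0)=\mathcal{M}(x)\big(f_d(x,\omega_0)-f(x,u)\big)$. Thus $\mathcal{S}$ is the set where the two vector fields coincide. $\mathcal{S}$ is invariant if every trajectory of the stated dynamics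 starting in $\mathcal{S}$ remains in $\mathcal{S}$ for all time.
   Formalization: The formal theorem assumes local existence and uniqueness of solutions, both for the closed loop and for the plant with constant input, and condition (ii) is required along every solution of the constant-input plant starting in S, not only pointwise on S; without these the equivalence fails. *)

theory Defs
  imports "HOL-Analysis.Analysis"
begin

text \<open>
  Generators, buses and transmission lines are indexed by finite types \<open>'g\<close>, \<open>'v\<close>, \<open>'t\<close>. The space
  of stacked vectors with \<open>n\<close> blocks of dimension \<open>d\<close> is \<open>real^d^'n\<close>. Machine quantities in
  \<open>real^5\<close> are indexed by \<open>2+3\<close> (stator | excitation, d-damper, q-damper), so that the
  \<open>2+3\<close> block matrices of the model can be written down as such.
\<close>

subsection \<open>Block matrices and Kronecker products\<close>

definition block_matrix ::
  "real^'a^'p \<Rightarrow> real^'b^'p \<Rightarrow> real^'a^'q \<Rightarrow> real^'b^'q \<Rightarrow> real^('a + 'b)^('p + 'q)" where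
  "block_matrix A B C D = (\<chi> r s.
     case r of
       Inl p \<Rightarrow> (case s of Inl a \<Rightarrow> A $ p $ a | Inr b \<Rightarrow> B $ p $ b)
     | Inr q \<Rightarrow> (case s of Inl a \<Rightarrow> C $ q $ a | Inr b \<Rightarrow> D $ q $ b))"

text \<open>\<open>kron_mult A B x\<close> is the product of the Kronecker product of \<open>A\<close> and \<open>B\<close> with the stacked
  vector \<open>x\<close>: its block \<open>k\<close> is the sum over \<open>l\<close> of \<open>A $ k $ l\<close> times \<open>B *v (x $ l)\<close>.\<close>

definition kron_mult :: "real^'n^'m \<Rightarrow> real^'q^'p \<Rightarrow> real^'q^'n \<Rightarrow> real^'p^'m" where
  "kron_mult A B x = (\<chi> k. \<Sum>l\<in>UNIV. (A $ k $ l) *\<^sub>R (B *v (x $ l)))"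

definition Rot :: "real \<Rightarrow> real^2^2" where
  "Rot \<phi> = vector [vector [cos \<phi>, - sin \<phi>], vector [sin \<phi>, cos \<phi>]]"

definition j2 :: "real^2^2" where
  "j2 = Rot (pi / 2)"

definition J5 :: "real^(2+3)^(2+3)" where
  "J5 = block_matrix j2 0 0 0"

text \<open>The \<open>5 \<times> 2\<close> matrix with upper block \<open>I\<^sub>2\<close> and lower block \<open>0\<close>.\<close>

definition stator_embed :: "real^2^(2+3)" where
  "stator_embed = (\<chi> r s. case r of Inl p \<Rightarrow> (mat 1 :: real^2^2) $ p $ s | Inr q \<Rightarrow> 0)"

subsection \<open>Parameters\<close>

record machine =
  mass_m :: real
  damp_d :: real
  res_s :: real
  res_f :: real
  res_d :: real
  res_q :: real
  ind_s :: real
  ind_sa :: real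
  ind_sf :: real
  ind_sd :: real
  ind_sq :: real
  ind_f :: real
  ind_fd :: real
  ind_d :: real
  ind_q :: real

definition resistance :: "machine \<Rightarrow> real^(2+3)^(2+3)" where
  "resistance a = block_matrix
     (vector [vector [res_s a, 0], vector [0, res_s a]]) 0
     0 (vector [vector [res_f a, 0, 0], vector [0, res_d a, 0], vector [0, 0, res_q a]])"

definition L_stator :: "machine \<Rightarrow> real \<Rightarrow> real^2^2" where
  "L_stator a \<phi> = ind_s a *\<^sub>R mat 1
     + Rot (2 * \<phi>) ** vector [vector [ind_sa a, 0], vector [0, - ind_sa a]]"

definition L_mutual :: "machine \<Rightarrow> real \<Rightarrow> real^3^2" where
  "L_mutual a \<phi> = Rot \<phi> **
     (vector [vector [ind_sf a, ind_sd a, 0], vector [0, 0, - ind_sq a]] :: real^3^2)"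

definition L_rotor :: "machine \<Rightarrow> real^3^3" where
  "L_rotor a = vector [vector [ind_f a, ind_fd a, 0],
                       vector [ind_fd a, ind_d a, 0],
                       vector [0, 0, ind_q a]]"

definition inductance :: "machine \<Rightarrow> real \<Rightarrow> real^(2+3)^(2+3)" where
  "inductance a \<phi> =
     block_matrix (L_stator a \<phi>) (L_mutual a \<phi>) (transpose (L_mutual a \<phi>)) (L_rotor a)"

definition machine_ok :: "machine \<Rightarrow> bool" where
  "machine_ok a \<longleftrightarrow>
     mass_m a > 0 \<and> damp_d a > 0 \<and>
     res_s a > 0 \<and> res_f a > 0 \<and> res_d a > 0 \<and> res_q a > 0 \<and>
     ind_sa a \<ge> 0 \<and>
     ind_s a > 0 \<and> ind_sf a > 0 \<and> ind_sd a > 0 \<and> ind_sq a > 0 \<and>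
     ind_f a > 0 \<and> ind_fd a > 0 \<and> ind_d a > 0 \<and> ind_q a > 0 \<and>
     (\<forall>\<phi>. invertible (inductance a \<phi>))"

text \<open>\<open>gen_bus k\<close> is the bus to which generator \<open>k\<close> is attached; \<open>load b\<close> is the static load
  current at bus \<open>b\<close> as a function of the bus voltage.\<close>

record ('g, 'v, 't) power_system =
  mach :: "'g \<Rightarrow> machine"
  gen_bus :: "'g \<Rightarrow> 'v"
  capac :: "'v \<Rightarrow> real"
  line_res :: "'t \<Rightarrow> real"
  line_ind :: "'t \<Rightarrow> real"
  incid :: "real^'t^'v"
  load :: "'v \<Rightarrow> real^2 \<Rightarrow> real^2"

definition oriented_incidence :: "real^'t^'v \<Rightarrow> bool" where
  "oriented_incidence E \<longleftrightarrow>
     (\<forall>l. \<exists>a b. a \<noteq> b \<and> (\<forall>k. E $ k $ l = (if k = a then 1 else if k = b then - 1 else 0)))"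

definition power_system_ok :: "('g::finite, 'v::finite, 't::finite) power_system \<Rightarrow> bool" where
  "power_system_ok P \<longleftrightarrow>
     (\<forall>k. machine_ok (mach P k)) \<and>
     inj (gen_bus P) \<and>
     (\<forall>b. capac P b > 0) \<and>
     (\<forall>l. line_res P l > 0 \<and> line_ind P l > 0) \<and>
     oriented_incidence (incid P) \<and>
     (\<forall>b. (\<forall>w. load P b differentiable (at w)) \<and> (\<forall>w. load P b w \<bullet> w \<ge> 0) \<and> load P b 0 = 0)"

subsection \<open>State space and vector fields\<close>

text \<open>States are \<open>(\<theta>, \<omega>, i, v, i\<^sub>T)\<close>, inputs are \<open>(\<tau>\<^sub>m, v\<^sub>f)\<close>.\<close>

type_synonym ('g, 'v, 't) state =
  "(real^'g) \<times> (real^'g) \<times> (real^(2+3)^'g) \<times> (real^2^'v) \<times> (real^2^'t)"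

type_synonym 'g input = "(real^'g) \<times> (real^'g)"

definition voltage :: "('g::finite, 'v::finite, 't::finite) state \<Rightarrow> real^2^'v" where
  "voltage = (\<lambda>(\<theta>, \<omega>, i, v, iT). v)"

definition torque ::
  "('g::finite, 'v::finite, 't::finite) power_system \<Rightarrow> real^'g \<Rightarrow> real^(2+3)^'g \<Rightarrow> real^'g" where
  "torque P \<theta> i = (\<chi> k.
     let L = inductance (mach P k) (\<theta> $ k)
     in 1 / 2 * ((i $ k) \<bullet> ((L ** J5 + transpose J5 ** L) *v (i $ k))))"

definition v_induced ::
  "('g::finite, 'v::finite, 't::finite) power_system \<Rightarrow> real^'g \<Rightarrow> real^'g \<Rightarrow> real^(2+3)^'g
     \<Rightarrow> real^(2+3)^'g" where
  "v_induced P \<theta> \<omega> i = (\<chi> k.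
     let L = inductance (mach P k) (\<theta> $ k)
     in (\<omega> $ k) *\<^sub>R ((L ** transpose J5 + J5 ** L) *v (i $ k)))"

definition load_current ::
  "('g::finite, 'v::finite, 't::finite) power_system \<Rightarrow> real^2^'v \<Rightarrow> real^2^'v" where
  "load_current P v = (\<chi> b. load P b (v $ b))"

definition gen_select :: "('g::finite, 'v::finite, 't::finite) power_system \<Rightarrow> real^'v^'g" where
  "gen_select P = (\<chi> k b. if gen_bus P k = b then 1 else 0)"

text \<open>The block-diagonal matrix \<open>\<M>(x)\<close>, as a linear map on the state space.\<close>

definition mass_map ::
  "('g::finite, 'v::finite, 't::finite) power_system \<Rightarrow> ('g, 'v, 't) state
     \<Rightarrow> ('g, 'v, 't) state \<Rightarrow> ('g, 'v, 't) state" where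
  "mass_map P x = (\<lambda>(\<theta>', \<omega>', i', v', iT').
     case x of (\<theta>, _) \<Rightarrow>
       (\<theta>',
        (\<chi> k. mass_m (mach P k) * (\<omega>' $ k)),
        (\<chi> k. inductance (mach P k) (\<theta> $ k) *v (i' $ k)),
        (\<chi> b. capac P b *\<^sub>R (v' $ b)),
        (\<chi> l. line_ind P l *\<^sub>R (iT' $ l))))"

text \<open>Both selection matrices between machine currents and bus voltages are Kronecker products
  built from \<open>gen_select\<close> and \<open>stator_embed\<close>; the excitation voltage enters in the first rotor
  component.\<close>

definition rhs ::
  "('g::finite, 'v::finite, 't::finite) power_system \<Rightarrow> ('g, 'v, 't) state \<Rightarrow> 'g input
     \<Rightarrow> ('g, 'v, 't) state" where
  "rhs P = (\<lambda>(\<theta>, \<omega>, i, v, iT) (\<tau>m, vf).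
     (\<omega>,
      - (\<chi> k. damp_d (mach P k) * (\<omega> $ k)) - torque P \<theta> i + \<tau>m,
      - (\<chi> k. resistance (mach P k) *v (i $ k)) + kron_mult (gen_select P) stator_embed v
        + (\<chi> k. (vf $ k) *\<^sub>R axis (Inr 1) 1) - v_induced P \<theta> \<omega> i,
      - kron_mult (transpose (gen_select P)) (transpose stator_embed) i
        - kron_mult (incid P) (mat 1) iT - load_current P v,
      - (\<chi> l. line_res P l *\<^sub>R (iT $ l)) + kron_mult (transpose (incid P)) (mat 1) v))"

definition field_f ::
  "('g::finite, 'v::finite, 't::finite) power_system \<Rightarrow> ('g, 'v, 't) state \<Rightarrow> 'g input
     \<Rightarrow> ('g, 'v, 't) state" where
  "field_f P x u = inv (mass_map P x) (rhs P x u)"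

definition field_fd ::
  "('g::finite, 'v::finite, 't::finite) state \<Rightarrow> real \<Rightarrow> ('g, 'v, 't) state" where
  "field_fd = (\<lambda>(\<theta>, \<omega>, i, v, iT) \<omega>\<^sub>0.
     (\<omega>\<^sub>0 *\<^sub>R (\<chi> k. 1),
      0,
      \<omega>\<^sub>0 *\<^sub>R kron_mult (mat 1) J5 i,
      \<omega>\<^sub>0 *\<^sub>R kron_mult (mat 1) j2 v,
      \<omega>\<^sub>0 *\<^sub>R kron_mult (mat 1) j2 iT))"

definition residual ::
  "('g::finite, 'v::finite, 't::finite) power_system \<Rightarrow> ('g, 'v, 't) state \<Rightarrow> 'g input \<Rightarrow> real
     \<Rightarrow> ('g, 'v, 't) state" where
  "residual P x u \<omega>\<^sub>0 = mass_map P x (field_fd x \<omega>\<^sub>0 - field_f P x u)"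

definition steady_set ::
  "('g::finite, 'v::finite, 't::finite) power_system \<Rightarrow> (('g, 'v, 't) state \<times> 'g input \<times> real) set"
  where
  "steady_set P = {(x, u, \<omega>\<^sub>0). residual P x u \<omega>\<^sub>0 = 0}"

definition closed_loop ::
  "('g::finite, 'v::finite, 't::finite) power_system
     \<Rightarrow> (real \<Rightarrow> ('g, 'v, 't) state \<Rightarrow> 'g input \<Rightarrow> real \<Rightarrow> 'g input)
     \<Rightarrow> real \<Rightarrow> real \<Rightarrow> ('g, 'v, 't) state \<times> 'g input \<Rightarrow> ('g, 'v, 't) state \<times> 'g input" where
  "closed_loop P g \<omega>\<^sub>0 t = (\<lambda>(x, u). (field_f P x u, g t x u \<omega>\<^sub>0))"

subsection \<open>Trajectories and invariance\<close>

text \<open>Time ranges over the positive reals; derivatives at the end points are one-sided.\<close>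

definition trajectory ::
  "(real \<Rightarrow> 'a::real_normed_vector \<Rightarrow> 'a) \<Rightarrow> real \<Rightarrow> real \<Rightarrow> (real \<Rightarrow> 'a) \<Rightarrow> bool" where
  "trajectory F t\<^sub>0 t\<^sub>1 z \<longleftrightarrow>
     0 < t\<^sub>0 \<and> t\<^sub>0 < t\<^sub>1 \<and>
     (\<forall>t\<in>{t\<^sub>0..t\<^sub>1}. (z has_vector_derivative F t (z t)) (at t within {t\<^sub>0..t\<^sub>1}))"

text \<open>Local existence and forward uniqueness for the initial value problem. By the Picard-Lindelof
  theorem this holds if \<open>F\<close> is continuous and locally Lipschitz in its second argument.\<close>

definition well_posed :: "(real \<Rightarrow> 'a::real_normed_vector \<Rightarrow> 'a) \<Rightarrow> bool" where
  "well_posed F \<longleftrightarrow>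
     (\<forall>t\<^sub>0 > 0. \<forall>z\<^sub>0. \<exists>t\<^sub>1 z. trajectory F t\<^sub>0 t\<^sub>1 z \<and> z t\<^sub>0 = z\<^sub>0) \<and>
     (\<forall>t\<^sub>0 t\<^sub>1 z w. trajectory F t\<^sub>0 t\<^sub>1 z \<longrightarrow> trajectory F t\<^sub>0 t\<^sub>1 w \<longrightarrow> z t\<^sub>0 = w t\<^sub>0 \<longrightarrow>
        (\<forall>t\<in>{t\<^sub>0..t\<^sub>1}. z t = w t))"

text \<open>The parameter \<open>\<omega>\<^sub>0\<close> of the vector field is constant along trajectories. A trajectory on an
  unbounded interval is covered through its restrictions to compact intervals.\<close>

definition invariant_set ::
  "(real \<Rightarrow> real \<Rightarrow> ('x::real_normed_vector \<times> 'u::real_normed_vector) \<Rightarrow> 'x \<times> 'u)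
     \<Rightarrow> ('x \<times> 'u \<times> real) set \<Rightarrow> bool" where
  "invariant_set F S \<longleftrightarrow>
     (\<forall>\<omega>\<^sub>0 t\<^sub>0 t\<^sub>1 x u. trajectory (F \<omega>\<^sub>0) t\<^sub>0 t\<^sub>1 (\<lambda>t. (x t, u t)) \<longrightarrow>
        (x t\<^sub>0, u t\<^sub>0, \<omega>\<^sub>0) \<in> S \<longrightarrow> (\<forall>t\<in>{t\<^sub>0..t\<^sub>1}. (x t, u t, \<omega>\<^sub>0) \<in> S))"

end

theory Submission
  imports Defs
begin

text \<open>
  Rotating all currents and voltages by an angle \<open>a\<close> and advancing all rotor angles by \<open>a\<close> is a
  symmetry of the network equations, once the load current is regarded as an independent input
  that is rotated along; the only obstruction to the symmetry of \<open>f\<close> itself is the load. The field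
  \<open>f\<^sub>d\<close> generates this rotation, and \<open>\<S>\<close> is where \<open>f\<close> and \<open>f\<^sub>d\<close> agree. If a trajectory stays in
  \<open>\<S>\<close>, its state is therefore a uniformly rotating one. The network equations determine the input and
  the load current from the state and its velocity, so the input is constant and the load current
  rotates, which gives (i) and (ii).

  Conversely, let the load current rotate along the trajectory of \<open>f(\<cdot>, u)\<close> through a point of
  \<open>\<S>\<close>. In rotating coordinates this trajectory solves an autonomous equation with a
  differentiable right-hand side that vanishes at the initial point, so it stays there for a short time.
  Hence it rotates uniformly and lies in \<open>\<S>\<close>; by (i) and uniqueness it is the closed-loop
  trajectory. In both directions, closedness of \<open>\<S>\<close> passes from short times to the whole interval.
\<close>

subsection \<open>Rotation matrices\<close>

lemma sum_sum_type:
  fixes f :: "'a::finite + 'b::finite \<Rightarrow> 'c::comm_monoid_add"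
  shows "sum f UNIV = (\<Sum>a\<in>UNIV. f (Inl a)) + (\<Sum>b\<in>UNIV. f (Inr b))"
  by (simp add: UNIV_Plus_UNIV [symmetric] sum.Plus del: UNIV_Plus_UNIV)

lemma block_matrix_nth [simp]:
  "block_matrix A B C D $ Inl p $ Inl a = A $ p $ a"
  "block_matrix A B C D $ Inl p $ Inr b = B $ p $ b"
  "block_matrix A B C D $ Inr q $ Inl a = C $ q $ a"
  "block_matrix A B C D $ Inr q $ Inr b = D $ q $ b"
  by (simp_all add: block_matrix_def)

lemma all_sum_type: "(\<forall>x :: 'a + 'b. Q x) \<longleftrightarrow> (\<forall>a. Q (Inl a)) \<and> (\<forall>b. Q (Inr b))"
  by (metis sumE)

lemma block_matrix_mult:
  fixes A :: "real^'a::finite^'p::finite" and D :: "real^'b::finite^'q::finite"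
    and A' :: "real^'c::finite^'a" and D' :: "real^'d::finite^'b"
  shows "block_matrix A B C D ** block_matrix A' B' C' D' =
    block_matrix (A ** A' + B ** C') (A ** B' + B ** D') (C ** A' + D ** C') (C ** B' + D ** D')"
  by (simp add: vec_eq_iff all_sum_type matrix_matrix_mult_def sum_sum_type)

lemma transpose_block_matrix:
  "transpose (block_matrix A B C D) =
     block_matrix (transpose A) (transpose C) (transpose B) (transpose D)"
  by (simp add: vec_eq_iff all_sum_type transpose_def)

lemma block_matrix_mat_1: "block_matrix (mat 1) 0 0 (mat 1) = mat 1"
  by (simp add: vec_eq_iff all_sum_type mat_def)

lemma matrix_mult_zero [simp]: "A ** 0 = (0 :: real^'n^'m)" "0 ** B = (0 :: real^'n^'m)"
  by (simp_all add: matrix_matrix_mult_def vec_eq_iff)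

lemma transpose_zero [simp]: "transpose (0 :: real^'n^'m) = 0"
  by (simp add: transpose_def vec_eq_iff)

lemma Rot_0: "Rot 0 = mat 1"
  by (simp add: Rot_def vec_eq_iff forall_2 mat_def)

lemma Rot_mult: "Rot a ** Rot b = Rot (a + b)"
  by (simp add: Rot_def vec_eq_iff forall_2 matrix_matrix_mult_def sum_2 cos_add sin_add)

lemma transpose_Rot: "transpose (Rot a) = Rot (- a)"
  by (simp add: Rot_def vec_eq_iff forall_2 transpose_def)

text \<open>Only the stator pair is turned: the excitation and damper currents are already expressed
  in the frame of the rotor, which moves along with the rotation.\<close>

definition Rot5 :: "real \<Rightarrow> real^(2+3)^(2+3)" where
  "Rot5 a = block_matrix (Rot a) 0 0 (mat 1)"

lemma Rot5_0: "Rot5 0 = mat 1"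
  by (simp add: Rot5_def Rot_0 block_matrix_mat_1)

lemma Rot5_mult: "Rot5 a ** Rot5 b = Rot5 (a + b)"
  by (simp add: Rot5_def block_matrix_mult Rot_mult)

lemma transpose_Rot5: "transpose (Rot5 a) = Rot5 (- a)"
  by (simp add: Rot5_def transpose_block_matrix transpose_Rot)

lemma Rot_j2: "Rot a ** j2 = j2 ** Rot a"
  by (simp add: j2_def Rot_mult add.commute)

lemma Rot5_J5: "Rot5 a ** J5 = J5 ** Rot5 a"
  by (simp add: Rot5_def J5_def block_matrix_mult Rot_j2)

lemma Rot5_transpose_J5: "Rot5 a ** transpose J5 = transpose J5 ** Rot5 a"
  \<comment> \<open>Transposing the commutation rule at angle \<open>- a\<close> reverses the
    products and turns \<open>Rot5 (- a)\<close> into \<open>Rot5 a\<close>.\<close>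
  using arg_cong [OF Rot5_J5, of transpose "- a"]
  by (simp add: matrix_transpose_mul transpose_Rot5)

text \<open>Both stator axes have the same resistance, so the stator block is scalar; the rotor
  block only meets the identity.\<close>

lemma Rot5_resistance: "Rot5 a ** resistance m = resistance m ** Rot5 a"
proof -
  have "Rot a ** vector [vector [r, 0], vector [0, r]] =
      vector [vector [r, 0], vector [0, r]] ** Rot a" for r
    by (simp add: Rot_def vec_eq_iff forall_2 matrix_matrix_mult_def sum_2)
  then show ?thesis
    by (simp add: Rot5_def resistance_def block_matrix_mult)
qed

lemma Rot5_stator_embed: "Rot5 a ** stator_embed = stator_embed ** Rot a"
  by (simp add: Rot5_def stator_embed_def vec_eq_iff all_sum_type matrix_matrix_mult_def
      sum_sum_type forall_2 forall_3 sum_2 sum_3 mat_def)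

lemma Rot_transpose_stator_embed:
  "Rot a ** transpose stator_embed = transpose stator_embed ** Rot5 a"
  using arg_cong [OF Rot5_stator_embed, of transpose "- a"]
  by (simp add: matrix_transpose_mul transpose_Rot transpose_Rot5)

lemma Rot5_axis_Inr: "Rot5 a *v axis (Inr q) 1 = axis (Inr q) 1"
  by (simp add: Rot5_def vec_eq_iff all_sum_type matrix_vector_mult_def sum_sum_type axis_def
      mat_def if_distrib cong: if_cong)

lemma matrix_scaleR:
  fixes A :: "real^'n^'m" and B :: "real^'p^'n"
  shows "(c *\<^sub>R A) ** B = c *\<^sub>R (A ** B)" "A ** (c *\<^sub>R B) = c *\<^sub>R (A ** B)"
  by (simp_all add: matrix_matrix_mult_def sum_distrib_left mult_ac vec_eq_iff)

lemma matrix_add_rdistrib: "(A + B) ** C = A ** C + B ** (C :: real^'p^'n)"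
  by (simp add: matrix_matrix_mult_def vec_eq_iff distrib_right sum.distrib)

text \<open>A rotor angle enters the inductance only through a change of frame. The saliency term
  picks up \<open>a\<close> from each side, which matches its double angle; the mutual blocks pick
  it up once, since the rotor side is not turned.\<close>

lemma inductance_rotate:
  "inductance m (\<phi> + a) = Rot5 a ** inductance m \<phi> ** Rot5 (- a)"
proof -
  define S :: "real^2^2" where "S = vector [vector [ind_sa m, 0], vector [0, - ind_sa m]]"
  \<comment> \<open>\<open>S\<close> is a multiple of a reflection, and conjugation by a reflection
    reverses the sense of a rotation.\<close>
  have S: "S ** Rot b = Rot (- b) ** S" for b
    by (simp add: S_def Rot_def vec_eq_iff forall_2 matrix_matrix_mult_def sum_2)
  have "Rot a ** L_stator m \<phi> ** Rot (- a) =
      ind_s m *\<^sub>R (Rot a ** Rot (- a)) + Rot a ** Rot (2 * \<phi>) ** (S ** Rot (- a))"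
    by (simp add: L_stator_def S_def matrix_add_ldistrib matrix_add_rdistrib matrix_mul_assoc
        matrix_scaleR)
  also have "Rot a ** Rot (2 * \<phi>) ** (S ** Rot (- a)) = Rot (a + 2 * \<phi> + a) ** S"
    by (simp add: S matrix_mul_assoc Rot_mult)
  finally have s: "Rot a ** L_stator m \<phi> ** Rot (- a) = L_stator m (\<phi> + a)"
    by (simp add: L_stator_def S_def Rot_mult Rot_0 algebra_simps)
  have l: "Rot a ** L_mutual m \<phi> = L_mutual m (\<phi> + a)"
    by (simp add: L_mutual_def matrix_mul_assoc Rot_mult add.commute)
  have "transpose (L_mutual m \<phi>) ** Rot (- a) = transpose (L_mutual m (\<phi> + a))"
    by (simp add: l [symmetric] matrix_transpose_mul transpose_Rot)
  then show ?thesis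
    by (simp add: inductance_def Rot5_def block_matrix_mult s l)
qed

text \<open>The inverse is written as a rotated constant matrix, so that its smoothness and symmetry
  in the angle come from \<open>Rot5\<close> and no derivative of matrix inversion is
  involved.\<close>

definition inv_inductance :: "machine \<Rightarrow> real \<Rightarrow> real^(2+3)^(2+3)" where
  "inv_inductance m \<phi> = Rot5 \<phi> ** matrix_inv (inductance m 0) ** Rot5 (- \<phi>)"

lemma inv_inductance:
  assumes "machine_ok m"
  shows "inductance m \<phi> ** inv_inductance m \<phi> = mat 1"
    and "inv_inductance m \<phi> ** inductance m \<phi> = mat 1"
proof -
  let ?L = "inductance m 0" and ?K = "matrix_inv (inductance m 0)"
  have "invertible ?L"
    using assms by (simp add: machine_ok_def)
  then have inv: "?L ** ?K = mat 1" "?K ** ?L = mat 1"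
    unfolding invertible_def matrix_inv_def by (metis (mono_tags, lifting) someI_ex)+
  have L: "inductance m \<phi> = Rot5 \<phi> ** ?L ** Rot5 (- \<phi>)"
    using inductance_rotate [of m 0 \<phi>] by simp
  have conj: "(Rot5 \<phi> ** X ** Rot5 (- \<phi>)) ** (Rot5 \<phi> ** Y ** Rot5 (- \<phi>)) = mat 1"
    if "X ** Y = mat 1" for X Y
  proof -
    have "(Rot5 \<phi> ** X ** Rot5 (- \<phi>)) ** (Rot5 \<phi> ** Y ** Rot5 (- \<phi>))
        = Rot5 \<phi> ** X ** (Rot5 (- \<phi>) ** Rot5 \<phi>) ** Y ** Rot5 (- \<phi>)"
      by (simp add: matrix_mul_assoc)
    also have "\<dots> = Rot5 \<phi> ** (X ** Y) ** Rot5 (- \<phi>)"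
      by (simp add: Rot5_mult Rot5_0 matrix_mul_assoc)
    finally show ?thesis
      by (simp add: that Rot5_mult Rot5_0)
  qed
  show "inductance m \<phi> ** inv_inductance m \<phi> = mat 1"
    and "inv_inductance m \<phi> ** inductance m \<phi> = mat 1"
    unfolding L inv_inductance_def by (rule conj, fact inv)+
qed

lemma inv_inductance_rotate:
  "inv_inductance m (\<phi> + a) = Rot5 a ** inv_inductance m \<phi> ** Rot5 (- a)"
proof -
  have "Rot5 (\<phi> + a) = Rot5 a ** Rot5 \<phi>" "Rot5 (- (\<phi> + a)) = Rot5 (- \<phi>) ** Rot5 (- a)"
    by (simp_all add: Rot5_mult add.commute)
  then show ?thesis
    by (simp add: inv_inductance_def matrix_mul_assoc)
qed

section \<open>Derivatives of vector-valued and matrix-valued functions\<close>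

lemma bounded_bilinear_matrix_vector_mult:
  "bounded_bilinear ((*v) :: real^'n^'m \<Rightarrow> real^'n \<Rightarrow> real^'m)"
  by (simp add: bilinear_conv_bounded_bilinear [symmetric] bilinear_def linear_iff
      matrix_vector_mult_add_rdistrib matrix_vector_right_distrib matrix_vector_mult_scaleR
      matrix_scaleR_vector_ac scaleR_matrix_vector_assoc [symmetric])

lemma bounded_bilinear_matrix_mult:
  "bounded_bilinear ((**) :: real^'n^'m \<Rightarrow> real^'p^'n \<Rightarrow> real^'p^'m)"
  by (simp add: bilinear_conv_bounded_bilinear [symmetric] bilinear_def linear_iff
      matrix_add_ldistrib matrix_add_rdistrib matrix_scaleR)

lemma has_derivative_vec_lambda:
  fixes f :: "'n::finite \<Rightarrow> 'a::real_normed_vector \<Rightarrow> 'b::euclidean_space"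
  assumes "\<And>i. (f i has_derivative f' i) F"
  shows "((\<lambda>x. \<chi> i. f i x) has_derivative (\<lambda>h. \<chi> i. f' i h)) F"
proof -
  \<comment> \<open>A vector is the sum of its axis embeddings, which are bounded linear, so the sum
    rule applies.\<close>
  have eq: "(\<chi> i. y i) = (\<Sum>i\<in>UNIV. axis i (y i))" for y :: "'n \<Rightarrow> 'b"
    by (simp add: vec_eq_iff axis_def if_distrib cong: if_cong)
  have "bounded_linear (axis i :: 'b \<Rightarrow> 'b^'n)" for i
    by (auto simp: linear_conv_bounded_linear [symmetric] linear_iff vec_eq_iff axis_def)
  then have "((\<lambda>x. axis i (f i x) :: 'b^'n) has_derivative (\<lambda>h. axis i (f' i h))) F" for i
    using assms [of i] by (rule bounded_linear.has_derivative)
  then show ?thesis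
    by (simp only: eq) (rule has_derivative_sum)
qed

lemma has_vector_derivative_vec_lambda:
  fixes f :: "'n::finite \<Rightarrow> real \<Rightarrow> 'b::euclidean_space"
  assumes "\<And>i. (f i has_vector_derivative f' i) F"
  shows "((\<lambda>x. \<chi> i. f i x) has_vector_derivative (\<chi> i. f' i)) F"
  using has_derivative_vec_lambda [OF assms [unfolded has_vector_derivative_def]]
  by (simp add: has_vector_derivative_def scaleR_vec_def)

lemma differentiable_vec_lambda:
  fixes f :: "'n::finite \<Rightarrow> 'a::real_normed_vector \<Rightarrow> 'b::euclidean_space"
  assumes "\<And>i. f i differentiable F"
  shows "(\<lambda>x. \<chi> i. f i x) differentiable F"
  using assms has_derivative_vec_lambda [of f _ F] unfolding differentiable_def by metis

lemma Rot_has_derivative: "(Rot has_vector_derivative j2 ** Rot a) (at a within S)"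
proof -
  \<comment> \<open>Written with conditionals, the matrix is open to the componentwise rule.\<close>
  have Rot: "Rot = (\<lambda>a. \<chi> i. \<chi> j. if i = 1 then if j = 1 then cos a else - sin a
      else if j = 1 then sin a else cos a)"
    by (simp add: fun_eq_iff Rot_def vec_eq_iff forall_2)
  have "((\<lambda>a. \<chi> i. \<chi> j. if i = 1 then if j = 1 then cos a else - sin a
      else if j = 1 then sin a else cos a) has_vector_derivative
      (\<chi> i. \<chi> j. if i = 1 then if j = 1 then - sin a else - cos a
      else if j = 1 then cos a else - sin a)) (at a within S)"
    by (intro has_vector_derivative_vec_lambda)
      (auto intro!: derivative_eq_intros
        simp: has_real_derivative_iff_has_vector_derivative [symmetric])
  moreover have "j2 ** Rot a = (\<chi> i. \<chi> j. if i = 1 then if j = 1 then - sin a else - cos a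
      else if j = 1 then cos a else - sin a)"
    by (simp add: j2_def Rot_mult) (simp add: vec_eq_iff forall_2 Rot_def cos_add sin_add)
  ultimately show ?thesis
    by (simp add: Rot)
qed

subsection \<open>Ordinary differential equations\<close>

text \<open>Differentiability at the zero \<open>x\<^sub>0\<close> bounds \<open>F\<close> linearly
  by the distance to \<open>x\<^sub>0\<close>. A Lipschitz bound against this one point is enough to
  exclude that a solution leaves it: over a short time the largest deviation is at most half of
  itself.\<close>

lemma stationary_locally:
  fixes F :: "'a::real_normed_vector \<Rightarrow> 'a" and y :: "real \<Rightarrow> 'a"
  assumes F: "F differentiable (at x\<^sub>0)" "F x\<^sub>0 = 0"
    and ab: "a < b"
    and y: "\<And>t. t \<in> {a..b} \<Longrightarrow> (y has_vector_derivative F (y t)) (at t within {a..b})"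
    and ya: "y a = x\<^sub>0"
  obtains d where "a < d" "d \<le> b" "\<And>t. t \<in> {a..d} \<Longrightarrow> y t = x\<^sub>0"
proof -
  obtain F' where F': "bounded_linear F'"
    and "\<forall>e>0. \<exists>r>0. \<forall>z. norm (z - x\<^sub>0) < r \<longrightarrow> norm (F z - F x\<^sub>0 - F' (z - x\<^sub>0)) \<le> e * norm (z - x\<^sub>0)"
    using F(1) unfolding differentiable_def has_derivative_at_alt by blast
  then obtain r where r: "r > 0"
    "\<And>z. norm (z - x\<^sub>0) < r \<Longrightarrow> norm (F z - F' (z - x\<^sub>0)) \<le> norm (z - x\<^sub>0)"
    using F(2) by (metis diff_zero mult_1 zero_less_one)
  obtain K where K: "K > 0" "\<And>h. norm (F' h) \<le> norm h * K"
    using bounded_linear.pos_bounded [OF F'] by blast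
  have calm: "norm (F z) \<le> (K + 1) * norm (z - x\<^sub>0)" if "norm (z - x\<^sub>0) < r" for z
    using norm_triangle_ineq [of "F z - F' (z - x\<^sub>0)" "F' (z - x\<^sub>0)"] r(2) [OF that] K(2) [of "z - x\<^sub>0"]
    by (simp add: algebra_simps)
  have cont: "continuous_on {a..b} y"
    unfolding continuous_on_eq_continuous_within
    by (intro ballI) (rule has_vector_derivative_continuous, rule y)
  then obtain s where s: "s > 0" "\<And>t. t \<in> {a..b} \<Longrightarrow> dist t a < s \<Longrightarrow> dist (y t) (y a) < r"
    using ab r(1) unfolding continuous_on_iff by (metis atLeastAtMost_iff less_le_not_le order_refl)
  \<comment> \<open>The term \<open>s / 2\<close> keeps \<open>y\<close> strictly inside the ball
    where the linear bound holds; \<open>1 / (2 * (K + 1))\<close> turns the mean value estimate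
    into a factor of one half.\<close>
  define d where "d = min b (a + min (s / 2) (1 / (2 * (K + 1))))"
  have "0 < min (s / 2) (1 / (2 * (K + 1)))"
    using s(1) K(1) by simp
  then have d: "a < d" "d \<le> b" "d \<le> a + s / 2" "d \<le> a + 1 / (2 * (K + 1))"
    using ab by (auto simp: d_def)
  have near: "norm (y t - x\<^sub>0) < r" if "t \<in> {a..d}" for t
    using s(2) [of t] that d s(1) by (auto simp: ya dist_norm)
  have "continuous_on {a..d} (\<lambda>t. norm (y t - x\<^sub>0))"
    using d by (intro continuous_intros continuous_on_subset [OF cont]) auto
  \<comment> \<open>\<open>m\<close> is the time of largest deviation; the speed on the whole
    interval is bounded by the deviation there.\<close>
  then obtain m where m: "m \<in> {a..d}" "\<And>t. t \<in> {a..d} \<Longrightarrow> norm (y t - x\<^sub>0) \<le> norm (y m - x\<^sub>0)"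
    using continuous_attains_sup [of "{a..d}" "\<lambda>t. norm (y t - x\<^sub>0)"] d by auto
  have "norm (y m - y a) \<le> ((K + 1) * norm (y m - x\<^sub>0)) * norm (m - a)"
  proof (rule differentiable_bound [of "{a..d}" y "\<lambda>t h. h *\<^sub>R F (y t)"])
    fix t assume t: "t \<in> {a..d}"
    then have "(y has_vector_derivative F (y t)) (at t within {a..d})"
      using d by (intro has_vector_derivative_within_subset [OF y]) auto
    then show "(y has_derivative (\<lambda>h. h *\<^sub>R F (y t))) (at t within {a..d})"
      by (simp add: has_vector_derivative_def)
    have "norm (F (y t)) \<le> (K + 1) * norm (y m - x\<^sub>0)"
      using calm [OF near [OF t]] m(2) [OF t] K(1)
      by (meson add_nonneg_nonneg less_imp_le mult_left_mono order_trans zero_le_one)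
    then show "onorm (\<lambda>h. h *\<^sub>R F (y t)) \<le> (K + 1) * norm (y m - x\<^sub>0)"
      by (simp add: onorm_scaleR_left onorm_id)
  qed (use m d in auto)
  also have "\<dots> \<le> ((K + 1) * norm (y m - x\<^sub>0)) * (1 / (2 * (K + 1)))"
    using m(1) d K(1) by (intro mult_left_mono) auto
  also have "\<dots> = norm (y m - x\<^sub>0) / 2"
    using K(1) by (simp add: field_simps)
  finally have "y m = x\<^sub>0"
    by (simp add: ya)
  then have "y t = x\<^sub>0" if "t \<in> {a..d}" for t
    using m(2) [OF that] by simp
  then show thesis
    using that d by blast
qed

text \<open>Continuous induction: closedness puts the supremum of the good times into the good set,
  and the local step would push past it unless it is the right end point.\<close>

lemma closed_continuation:
  fixes z :: "real \<Rightarrow> 'a::topological_space"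
  assumes cont: "continuous_on {a..b} z" and S: "closed S" and za: "z a \<in> S"
    and step: "\<And>s. a \<le> s \<Longrightarrow> s < b \<Longrightarrow> z s \<in> S \<Longrightarrow> \<exists>d>s. \<forall>t\<in>{s..d}. t \<le> b \<longrightarrow> z t \<in> S"
    and t: "t \<in> {a..b}"
  shows "z t \<in> S"
proof -
  define T where "T = {s \<in> {a..b}. z s \<in> S}"
  have "closed T"
    using continuous_closed_preimage [OF cont _ S] by (simp add: T_def vimage_def Int_def)
  \<comment> \<open>Asking for whole initial segments, and not just for single good times, ensures
    that every time below the supremum is good.\<close>
  define A where "A = {s \<in> {a..b}. {a..s} \<subseteq> T}"
  have aA: "a \<in> A"
    using t za by (auto simp: A_def T_def)
  have bdd: "bdd_above A"
    by (auto simp: A_def bdd_above_def)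
  define m where "m = Sup A"
  have am: "a \<le> m"
    using aA bdd by (simp add: m_def cSup_upper)
  have mb: "m \<le> b"
    using aA by (auto simp: m_def A_def intro!: cSup_least)
  have less: "{a..<m} \<subseteq> T"
  proof
    fix s assume "s \<in> {a..<m}"
    then obtain s' where "s' \<in> A" "s < s'"
      using less_cSup_iff [of A s] aA bdd by (auto simp: m_def)
    then show "s \<in> T"
      using \<open>s \<in> {a..<m}\<close> by (auto simp: A_def)
  qed
  have mT: "{a..m} \<subseteq> T"
  proof (cases "a = m")
    case True
    then show ?thesis
      using aA by (auto simp: A_def)
  next
    case False
    then have "a < m"
      using am by simp
    then show ?thesis
      using closure_minimal [OF less \<open>closed T\<close>] by simp
  qed
  have "m = b"
  proof (rule ccontr)
    assume "m \<noteq> b"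
    then have "m < b"
      using mb by simp
    moreover have "z m \<in> S"
      using mT am by (auto simp: T_def)
    ultimately obtain d where d: "d > m" "\<forall>t\<in>{m..d}. t \<le> b \<longrightarrow> z t \<in> S"
      using step am by blast
    \<comment> \<open>The local step speaks only of times up to \<open>b\<close>, while
      \<open>d\<close> may lie beyond it.\<close>
    have "{a..min d b} \<subseteq> T"
    proof
      fix s assume "s \<in> {a..min d b}"
      then show "s \<in> T"
        using mT d(2) by (cases "s \<le> m") (auto simp: T_def)
    qed
    then have "min d b \<in> A"
      using d(1) \<open>m < b\<close> am by (auto simp: A_def)
    then have "min d b \<le> m"
      using bdd by (simp add: m_def cSup_upper)
    then show False
      using d(1) \<open>m < b\<close> by simp
  qed
  then show ?thesis
    using mT t by (auto simp: T_def)
qed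

section \<open>Restriction, existence and uniqueness of trajectories\<close>

lemma trajectory_restrict:
  assumes "trajectory F t\<^sub>0 t\<^sub>1 z" "t\<^sub>0 \<le> a" "a < b" "b \<le> t\<^sub>1"
  shows "trajectory F a b z"
  unfolding trajectory_def
proof (intro conjI ballI)
  fix t assume "t \<in> {a..b}"
  then have "(z has_vector_derivative F t (z t)) (at t within {t\<^sub>0..t\<^sub>1})"
    using assms by (simp add: trajectory_def)
  then show "(z has_vector_derivative F t (z t)) (at t within {a..b})"
    by (rule has_vector_derivative_within_subset) (use assms in auto)
qed (use assms in \<open>auto simp: trajectory_def\<close>)

lemma trajectory_continuous_on:
  "trajectory F t\<^sub>0 t\<^sub>1 z \<Longrightarrow> continuous_on {t\<^sub>0..t\<^sub>1} z"
  unfolding trajectory_def continuous_on_eq_continuous_within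
  by (intro ballI) (rule has_vector_derivative_continuous, blast)

lemma well_posed_exists:
  assumes "well_posed F" "0 < t\<^sub>0"
  obtains t\<^sub>1 z where "trajectory F t\<^sub>0 t\<^sub>1 z" "z t\<^sub>0 = z\<^sub>0"
  using assms unfolding well_posed_def by blast

lemma well_posed_unique:
  assumes "well_posed F" "trajectory F t\<^sub>0 t\<^sub>1 z" "trajectory F t\<^sub>0 t\<^sub>1 w" "z t\<^sub>0 = w t\<^sub>0" "t \<in> {t\<^sub>0..t\<^sub>1}"
  shows "z t = w t"
  using assms unfolding well_posed_def by blast

subsection \<open>Differentiability of the machine matrices\<close>

lemma differentiable_bilinear:
  assumes "bounded_bilinear h" "f differentiable (at x within S)" "g differentiable (at x within S)"
  shows "(\<lambda>x. h (f x) (g x)) differentiable (at x within S)"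
  using bounded_bilinear.FDERIV [OF assms(1)] assms(2,3) unfolding differentiable_def by metis

lemmas differentiable_matrix_vector_mult =
  differentiable_bilinear [OF bounded_bilinear_matrix_vector_mult]
lemmas differentiable_matrix_mult = differentiable_bilinear [OF bounded_bilinear_matrix_mult]

lemma differentiable_vec_nth:
  "f differentiable F \<Longrightarrow> (\<lambda>x. f x $ k) differentiable F"
  unfolding differentiable_def
  using bounded_linear.has_derivative [OF bounded_linear_vec_nth] by metis

lemma differentiable_fst_snd:
  assumes "f differentiable F"
  shows "(\<lambda>x. fst (f x)) differentiable F" "(\<lambda>x. snd (f x)) differentiable F"
  using assms has_derivative_fst has_derivative_snd unfolding differentiable_def by metis+

lemma Rot5_has_derivative: "(Rot5 has_vector_derivative J5 ** Rot5 a) (at a within S)"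
proof -
  \<comment> \<open>The constant rotor block is split off: the rest is linear in the rotated stator
    block, and \<open>J5\<close> annihilates the rotor part.\<close>
  let ?B = "\<lambda>A. block_matrix A 0 0 (0 :: real^3^3) :: real^(2+3)^(2+3)"
  have "bounded_linear ?B"
    by (simp add: linear_conv_bounded_linear [symmetric] linear_iff vec_eq_iff all_sum_type)
  then have "((\<lambda>a. ?B (Rot a)) has_vector_derivative ?B (j2 ** Rot a)) (at a within S)"
    by (rule bounded_linear.has_vector_derivative [OF _ Rot_has_derivative])
  then have "((\<lambda>a. ?B (Rot a) + block_matrix 0 0 0 (mat 1)) has_vector_derivative ?B (j2 ** Rot a) + 0)
      (at a within S)"
    by (rule has_vector_derivative_add) (rule has_vector_derivative_const)
  moreover have "(\<lambda>a. ?B (Rot a) + block_matrix 0 0 0 (mat 1)) = Rot5"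
    by (simp add: fun_eq_iff Rot5_def vec_eq_iff all_sum_type)
  moreover have "?B (j2 ** Rot a) = J5 ** Rot5 a"
    by (simp add: Rot5_def J5_def block_matrix_mult)
  ultimately show ?thesis
    by simp
qed

lemma differentiable_Rot5:
  assumes "f differentiable (at x within S)"
  shows "(\<lambda>x. Rot5 (f x)) differentiable (at x within S)"
proof (rule differentiable_compose [OF _ assms])
  show "Rot5 differentiable (at (f x))"
    using Rot5_has_derivative [of "f x" UNIV]
    unfolding has_vector_derivative_def by (rule differentiableI)
qed

lemma differentiable_inductance:
  assumes "f differentiable (at x within S)"
  shows "(\<lambda>x. inductance m (f x)) differentiable (at x within S)"
proof -
  have "inductance m (f x) = Rot5 (f x) ** inductance m 0 ** Rot5 (- f x)" for x
    using inductance_rotate [of m 0 "f x"] by (simp only: add_0)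
  then show ?thesis
    by (simp only:) (intro differentiable_matrix_mult differentiable_Rot5 differentiable_const
        differentiable_minus assms)
qed

lemma differentiable_inv_inductance:
  assumes "f differentiable (at x within S)"
  shows "(\<lambda>x. inv_inductance m (f x)) differentiable (at x within S)"
  unfolding inv_inductance_def
  by (intro differentiable_matrix_mult differentiable_Rot5 differentiable_const
      differentiable_minus assms)

text \<open>The product rule in a moving frame, stated for any matrix path solving
  \<open>M' = J M\<close> so that it serves both \<open>Rot\<close> and \<open>Rot5\<close>.\<close>

lemma rotation_mult_has_vector_derivative:
  fixes M :: "real \<Rightarrow> real^'n^'n"
  assumes M: "\<And>a S. (M has_vector_derivative J ** M a) (at a within S)"
    and y: "(y has_vector_derivative y') (at t within S)"
    and a: "(\<alpha> has_real_derivative a) (at t within S)"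
  shows "((\<lambda>t. M (\<alpha> t) *v y t) has_vector_derivative
    M (\<alpha> t) *v y' + a *\<^sub>R (J *v (M (\<alpha> t) *v y t))) (at t within S)"
proof -
  have "((M \<circ> \<alpha>) has_vector_derivative a *\<^sub>R (J ** M (\<alpha> t))) (at t within S)"
    using a M
    by (intro vector_diff_chain_within) (simp_all add: has_real_derivative_iff_has_vector_derivative)
  from bounded_bilinear.has_vector_derivative [OF bounded_bilinear_matrix_vector_mult this y]
  show ?thesis
    by (simp only: o_def matrix_vector_mul_assoc scaleR_matrix_vector_assoc)
qed

subsection \<open>Rotational symmetry of the network\<close>

text \<open>A blockwise formula that takes the place of the abstract \<open>inv\<close> in
  \<open>field_f\<close>; it is a genuine inverse of \<open>mass_map\<close> for admissible
  parameters.\<close>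

definition mass_inv ::
  "('g::finite, 'v::finite, 't::finite) power_system \<Rightarrow> ('g, 'v, 't) state
     \<Rightarrow> ('g, 'v, 't) state \<Rightarrow> ('g, 'v, 't) state" where
  "mass_inv P x = (\<lambda>(\<theta>', \<omega>', i', v', iT').
     case x of (\<theta>, _) \<Rightarrow>
       (\<theta>',
        (\<chi> k. (\<omega>' $ k) / mass_m (mach P k)),
        (\<chi> k. inv_inductance (mach P k) (\<theta> $ k) *v (i' $ k)),
        (\<chi> b. (1 / capac P b) *\<^sub>R (v' $ b)),
        (\<chi> l. (1 / line_ind P l) *\<^sub>R (iT' $ l))))"

text \<open>A free current \<open>c\<close> replaces the static load current, which need not commute with rotations.\<close>

definition net_rhs ::
  "('g::finite, 'v::finite, 't::finite) power_system \<Rightarrow> ('g, 'v, 't) state \<Rightarrow> 'g input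
     \<Rightarrow> real^2^'v \<Rightarrow> ('g, 'v, 't) state" where
  "net_rhs P = (\<lambda>(\<theta>, \<omega>, i, v, iT) (\<tau>m, vf) c.
     (\<omega>,
      - (\<chi> k. damp_d (mach P k) * (\<omega> $ k)) - torque P \<theta> i + \<tau>m,
      - (\<chi> k. resistance (mach P k) *v (i $ k)) + kron_mult (gen_select P) stator_embed v
        + (\<chi> k. (vf $ k) *\<^sub>R axis (Inr 1) 1) - v_induced P \<theta> \<omega> i,
      - kron_mult (transpose (gen_select P)) (transpose stator_embed) i
        - kron_mult (incid P) (mat 1) iT - c,
      - (\<chi> l. line_res P l *\<^sub>R (iT $ l)) + kron_mult (transpose (incid P)) (mat 1) v))"

definition net_field ::
  "('g::finite, 'v::finite, 't::finite) power_system \<Rightarrow> ('g, 'v, 't) state \<Rightarrow> 'g input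
     \<Rightarrow> real^2^'v \<Rightarrow> ('g, 'v, 't) state" where
  "net_field P x u c = mass_inv P x (net_rhs P x u c)"

lemma mass_inv_mass_map:
  assumes "power_system_ok P"
  shows "mass_inv P x (mass_map P x w) = w" "mass_map P x (mass_inv P x w) = w"
proof -
  have ok: "machine_ok (mach P k)" "capac P b > 0" "line_ind P l > 0" for k b l
    using assms by (auto simp: power_system_ok_def)
  then have "mass_m (mach P k) > 0" for k
    by (auto simp: machine_ok_def)
  then have "mass_m (mach P k) \<noteq> 0" "capac P b \<noteq> 0" "line_ind P l \<noteq> 0" for k b l
    using ok by (simp_all add: less_imp_neq [symmetric])
  with ok(1) show "mass_inv P x (mass_map P x w) = w" "mass_map P x (mass_inv P x w) = w"
    by (cases x; cases w; simp add: mass_inv_def mass_map_def vec_eq_iff matrix_vector_mul_assoc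
        inv_inductance)+
qed

lemma field_f_eq_net_field:
  assumes "power_system_ok P"
  shows "field_f P x u = net_field P x u (load_current P (voltage x))"
proof -
  have "inv (mass_map P x) = mass_inv P x"
    by (rule inv_equality) (simp_all add: mass_inv_mass_map assms)
  moreover have "rhs P x u = net_rhs P x u (load_current P (voltage x))"
    by (simp add: rhs_def net_rhs_def voltage_def split: prod.split)
  ultimately show ?thesis
    by (simp add: field_f_def net_field_def)
qed

lemma mass_map_eq_0_iff:
  assumes "power_system_ok P"
  shows "mass_map P x w = 0 \<longleftrightarrow> w = 0"
proof -
  have "mass_map P x 0 = 0"
    by (simp add: mass_map_def zero_prod_def vec_eq_iff split: prod.split)
  then show ?thesis
    by (metis assms mass_inv_mass_map(1))
qed

lemma steady_set_iff:
  assumes "power_system_ok P"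
  shows "(x, u, \<omega>\<^sub>0) \<in> steady_set P \<longleftrightarrow> field_f P x u = field_fd x \<omega>\<^sub>0"
  by (auto simp: steady_set_def residual_def mass_map_eq_0_iff assms)

text \<open>Torque, excitation and load current enter additively in the equations for speed, machine
  current and voltage, and the mass matrix is invertible. The velocity at a given state therefore
  reveals them; this is the source of conditions (i) and (ii).\<close>

lemma net_field_inject:
  assumes "power_system_ok P"
  shows "net_field P x u c = net_field P x u' c' \<longleftrightarrow> u = u' \<and> c = c'"
proof
  assume "net_field P x u c = net_field P x u' c'"
  then have "net_rhs P x u c = net_rhs P x u' c'"
    unfolding net_field_def by (metis assms mass_inv_mass_map(2))
  then show "u = u' \<and> c = c'"
    \<comment> \<open>The excitation voltage multiplies a nonzero axis vector, so it can be
      cancelled.\<close>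
    by (auto simp: net_rhs_def vec_eq_iff split: prod.splits) (metis axis_nth zero_neq_one)
qed auto

section \<open>Blockwise action of matrices on stacked vectors\<close>

lemma kron_mult_mat_1: "kron_mult (mat 1) B x = (\<chi> k. B *v (x $ k))"
  by (simp add: kron_mult_def mat_def vec_eq_iff if_distrib if_distribR cong: if_cong)

text \<open>The factor \<open>A\<close> mixes blocks while the rotations act inside each block, so
  only the inner factor \<open>B\<close> has to intertwine them.\<close>

lemma kron_mult_commute:
  fixes A :: "real^'n^'m" and N :: "real^'p^'p"
  assumes "B ** M = N ** B"
  shows "kron_mult A B (kron_mult (mat 1) M x) = kron_mult (mat 1) N (kron_mult A B x)"
proof -
  have "N *v (\<Sum>l\<in>UNIV. y l) = (\<Sum>l\<in>UNIV. N *v y l)" for y :: "'n \<Rightarrow> real^'p"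
    by (rule linear_sum) (rule matrix_vector_mul_linear)
  then show ?thesis
    unfolding kron_mult_mat_1
    by (simp add: kron_mult_def matrix_vector_mul_assoc assms matrix_vector_mult_scaleR)
qed

lemma kron_mult_mat_1_linear:
  "kron_mult (mat 1) B (x + y) = kron_mult (mat 1) B x + kron_mult (mat 1) B y"
  "kron_mult (mat 1) B (x - y) = kron_mult (mat 1) B x - kron_mult (mat 1) B y"
  "kron_mult (mat 1) B (- x) = - kron_mult (mat 1) B x"
  "kron_mult (mat 1) B (c *\<^sub>R x) = c *\<^sub>R kron_mult (mat 1) B x"
  "kron_mult (mat 1) B 0 = 0"
  by (simp_all add: kron_mult_mat_1 vec_eq_iff matrix_vector_right_distrib
      matrix_vector_mult_scaleR [of B "-1", simplified]
      matrix_vector_mult_diff_distrib matrix_vector_mult_scaleR)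

lemma kron_mult_mat_1_mult:
  "kron_mult (mat 1) A (kron_mult (mat 1) B x) = kron_mult (mat 1) (A ** B) x"
  by (simp add: kron_mult_mat_1 matrix_vector_mul_assoc)

text \<open>The symmetry of the model. It shifts the rotor angles and is therefore affine.\<close>

definition spin ::
  "real \<Rightarrow> ('g::finite, 'v::finite, 't::finite) state \<Rightarrow> ('g, 'v, 't) state" where
  "spin a = (\<lambda>(\<theta>, \<omega>, i, v, iT).
     (\<theta> + (\<chi> k. a), \<omega>, kron_mult (mat 1) (Rot5 a) i, kron_mult (mat 1) (Rot a) v,
      kron_mult (mat 1) (Rot a) iT))"

text \<open>The linear part of \<open>spin\<close>, which is its action on velocities: the shift of
  the angles disappears.\<close>

definition spin_lin ::
  "real \<Rightarrow> ('g::finite, 'v::finite, 't::finite) state \<Rightarrow> ('g, 'v, 't) state" where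
  "spin_lin a = (\<lambda>(\<theta>, \<omega>, i, v, iT).
     (\<theta>, \<omega>, kron_mult (mat 1) (Rot5 a) i, kron_mult (mat 1) (Rot a) v,
      kron_mult (mat 1) (Rot a) iT))"

lemma spin_0 [simp]: "spin 0 x = x"
  by (simp add: spin_def kron_mult_mat_1 Rot_0 Rot5_0 vec_eq_iff split: prod.split)

lemma spin_spin: "spin a (spin b x) = spin (a + b) x"
  by (simp add: spin_def kron_mult_mat_1_mult Rot_mult Rot5_mult vec_eq_iff split: prod.split)

lemma field_fd_spin: "field_fd (spin a x) w = spin_lin a (field_fd x w)"
  by (simp add: field_fd_def spin_def spin_lin_def kron_mult_mat_1_linear kron_mult_mat_1_mult
      Rot_j2 Rot5_J5 split: prod.split)

lemma inner_Rot5: "(Rot5 a *v y) \<bullet> (Rot5 a *v z) = y \<bullet> z"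
proof -
  have "(Rot5 a *v y) \<bullet> (Rot5 a *v z) = y \<bullet> (transpose (Rot5 a) *v (Rot5 a *v z))"
    using dot_lmul_matrix [of y "transpose (Rot5 a)" "Rot5 a *v z"]
    by (simp only: vector_transpose_matrix)
  also have "transpose (Rot5 a) *v (Rot5 a *v z) = z"
    by (simp only: transpose_Rot5 matrix_vector_mul_assoc Rot5_mult add.left_inverse Rot5_0
        matrix_vector_mul_lid)
  finally show ?thesis .
qed

text \<open>Since \<open>J5\<close> and its transpose commute with rotations, the matrix of the
  quadratic form is conjugated exactly as the inductance is; orthogonality of \<open>Rot5\<close>
  then cancels the rotation.\<close>

lemma torque_spin:
  "torque P (\<theta> + (\<chi> k. a)) (kron_mult (mat 1) (Rot5 a) i) = torque P \<theta> i"
proof -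
  have "(Rot5 a *v y) \<bullet> ((L' ** J5 + transpose J5 ** L') *v (Rot5 a *v y)) =
      y \<bullet> ((L ** J5 + transpose J5 ** L) *v y)"
    if L': "L' = Rot5 a ** L ** Rot5 (- a)" for y L L'
  proof -
    have 1: "L' ** J5 ** Rot5 a = Rot5 a ** (L ** J5)"
      by (simp add: L' matrix_mul_assoc [symmetric] Rot5_J5 [symmetric])
        (simp add: matrix_mul_assoc Rot5_mult Rot5_0)
    have 2: "transpose J5 ** L' ** Rot5 a = Rot5 a ** (transpose J5 ** L)"
      by (simp add: L' matrix_mul_assoc [symmetric] Rot5_mult Rot5_0)
        (simp add: matrix_mul_assoc Rot5_transpose_J5)
    have "(L' ** J5 + transpose J5 ** L') ** Rot5 a = Rot5 a ** (L ** J5 + transpose J5 ** L)"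
      by (simp add: matrix_add_rdistrib matrix_add_ldistrib 1 2)
    then have "(Rot5 a *v y) \<bullet> ((L' ** J5 + transpose J5 ** L') *v (Rot5 a *v y)) =
        (Rot5 a *v y) \<bullet> (Rot5 a *v ((L ** J5 + transpose J5 ** L) *v y))"
      by (simp only: matrix_vector_mul_assoc)
    also have "\<dots> = y \<bullet> ((L ** J5 + transpose J5 ** L) *v y)"
      by (rule inner_Rot5)
    finally show ?thesis .
  qed
  from this [OF inductance_rotate] show ?thesis
    by (simp only: torque_def kron_mult_mat_1 Let_def vec_lambda_beta vector_add_component)
qed

lemma v_induced_spin:
  "v_induced P (\<theta> + (\<chi> k. a)) \<omega> (kron_mult (mat 1) (Rot5 a) i) =
     kron_mult (mat 1) (Rot5 a) (v_induced P \<theta> \<omega> i)"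
proof -
  have "(L' ** transpose J5 + J5 ** L') ** Rot5 a = Rot5 a ** (L ** transpose J5 + J5 ** L)"
    if L': "L' = Rot5 a ** L ** Rot5 (- a)" for L L'
  proof -
    have 1: "L' ** transpose J5 ** Rot5 a = Rot5 a ** (L ** transpose J5)"
      by (simp add: L' matrix_mul_assoc [symmetric] Rot5_transpose_J5 [symmetric])
        (simp add: matrix_mul_assoc Rot5_mult Rot5_0)
    have 2: "J5 ** L' ** Rot5 a = Rot5 a ** (J5 ** L)"
      by (simp add: L' matrix_mul_assoc [symmetric] Rot5_mult Rot5_0)
        (simp add: matrix_mul_assoc Rot5_J5)
    show ?thesis
      by (simp add: matrix_add_rdistrib matrix_add_ldistrib 1 2)
  qed
  from this [OF inductance_rotate] show ?thesis
    by (simp only: v_induced_def kron_mult_mat_1 Let_def matrix_vector_mult_scaleR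
        matrix_vector_mul_assoc vec_lambda_beta vector_add_component)
qed

text \<open>Each term is invariant or turns along. The input \<open>u\<close> stays fixed because
  torques are scalars and the excitation acts along a rotor axis that \<open>Rot5\<close> does not
  move.\<close>

lemma net_rhs_spin:
  "net_rhs P (spin a x) u (kron_mult (mat 1) (Rot a) c) = spin_lin a (net_rhs P x u c)"
proof -
  have R: "(\<chi> k. resistance (mach P k) *v (kron_mult (mat 1) (Rot5 a) i $ k)) =
      kron_mult (mat 1) (Rot5 a) (\<chi> k. resistance (mach P k) *v (i $ k))" for i
    by (simp add: kron_mult_mat_1 matrix_vector_mul_assoc Rot5_resistance)
  have V: "kron_mult (mat 1) (Rot5 a) (\<chi> k. vf $ k *\<^sub>R axis (Inr 1) 1) =
      (\<chi> k. vf $ k *\<^sub>R axis (Inr 1) 1)" for vf :: "real^'a"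
    by (simp add: kron_mult_mat_1 matrix_vector_mult_scaleR Rot5_axis_Inr)
  have T: "(\<chi> l. line_res P l *\<^sub>R (kron_mult (mat 1) (Rot a) iT $ l)) =
      kron_mult (mat 1) (Rot a) (\<chi> l. line_res P l *\<^sub>R (iT $ l))" for iT
    by (simp add: kron_mult_mat_1 matrix_vector_mult_scaleR)
  obtain \<theta> \<omega> i v iT where x: "x = (\<theta>, \<omega>, i, v, iT)"
    by (cases x)
  obtain \<tau> vf where u: "u = (\<tau>, vf)"
    by (cases u)
  have S: "kron_mult A stator_embed (kron_mult (mat 1) (Rot a) v) =
      kron_mult (mat 1) (Rot5 a) (kron_mult A stator_embed v)" for A v
    by (rule kron_mult_commute) (rule Rot5_stator_embed [symmetric])
  have S': "kron_mult A (transpose stator_embed) (kron_mult (mat 1) (Rot5 a) i) =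
      kron_mult (mat 1) (Rot a) (kron_mult A (transpose stator_embed) i)" for A i
    by (rule kron_mult_commute) (rule Rot_transpose_stator_embed [symmetric])
  have I: "kron_mult A (mat 1) (kron_mult (mat 1) (Rot a) v) =
      kron_mult (mat 1) (Rot a) (kron_mult A (mat 1) v)" for A v
    by (rule kron_mult_commute) simp
  show ?thesis
    by (simp only: x u net_rhs_def spin_def spin_lin_def prod.case torque_spin v_induced_spin
        kron_mult_mat_1_linear R T V S S' I)
qed

lemma mass_inv_spin: "mass_inv P (spin a x) (spin_lin a w) = spin_lin a (mass_inv P x w)"
  by (cases x; cases w)
    (simp add: mass_inv_def spin_def spin_lin_def kron_mult_mat_1 matrix_vector_mul_assoc
      inv_inductance_rotate matrix_mul_assoc [symmetric] Rot5_mult Rot5_0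
      matrix_vector_mult_scaleR)

lemma net_field_spin:
  "net_field P (spin a x) u (kron_mult (mat 1) (Rot a) c) = spin_lin a (net_field P x u c)"
  by (simp add: net_field_def net_rhs_spin mass_inv_spin)

subsection \<open>Trajectories\<close>

lemma kron_mult_differentiable:
  assumes "f differentiable (at x within S)"
  shows "(\<lambda>x. kron_mult A B (f x)) differentiable (at x within S)"
  unfolding kron_mult_def
  by (intro differentiable_vec_lambda differentiable_sum differentiable_scaleR differentiable_const
      differentiable_matrix_vector_mult differentiable_vec_nth assms finite_class.finite_UNIV ballI)

lemmas differentiable_model = differentiable_fst_snd differentiable_vec_nth differentiable_vec_lambda
  differentiable_matrix_vector_mult differentiable_matrix_mult kron_mult_differentiable
  differentiable_inductance differentiable_inv_inductance differentiable_Pair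
  differentiable_add differentiable_diff differentiable_minus differentiable_scaleR
  differentiable_mult differentiable_inner differentiable_ident differentiable_const

text \<open>Differentiability is joint in state, input and current, so that the current can later be
  either the load current or a frozen constant.\<close>

lemma net_field_differentiable:
  "(\<lambda>(x, u, c). net_field P x u c) differentiable (at z)"
proof -
  have eq: "(\<lambda>(x, u, c). net_field P x u c) = (\<lambda>z.
      let x = fst z; u = fst (snd z); c = snd (snd z); w = net_rhs P x u c in
      (fst w,
        (\<chi> k. (fst (snd w) $ k) * (1 / mass_m (mach P k))),
        (\<chi> k. inv_inductance (mach P k) (fst x $ k) *v (fst (snd (snd w)) $ k)),
        (\<chi> b. (1 / capac P b) *\<^sub>R (fst (snd (snd (snd w))) $ b)),
        (\<chi> l. (1 / line_ind P l) *\<^sub>R (snd (snd (snd (snd w))) $ l))))"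
    by (simp add: fun_eq_iff net_field_def mass_inv_def Let_def split_beta)
  have "(\<lambda>z. net_rhs P (fst z) (fst (snd z)) (snd (snd z))) differentiable (at z)"
    unfolding net_rhs_def split_beta torque_def v_induced_def Let_def
    by (intro differentiable_model)
  then show ?thesis
    unfolding eq Let_def
    by (intro differentiable_model)
qed

lemma field_fd_differentiable: "(\<lambda>x. field_fd x w) differentiable (at x)"
  unfolding field_fd_def split_beta by (intro differentiable_model)

lemma load_current_continuous:
  assumes "power_system_ok P"
  shows "continuous_on S (load_current P)"
proof -
  have "load P b differentiable (at w)" for b w
    using assms by (simp add: power_system_ok_def)
  then have "continuous_on UNIV (load P b)" for b
    by (simp add: continuous_at_imp_continuous_on differentiable_imp_continuous_within)
  then have "continuous_on S (\<lambda>v. load P b (v $ b))" for b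
    by (rule continuous_on_compose2 [OF _ continuous_on_component [OF continuous_on_id] subset_UNIV])
  then show ?thesis
    unfolding load_current_def by (intro continuous_on_vec_lambda)
qed

text \<open>For fixed frequency this is the set where two continuous maps agree; continuity of the
  load current comes from its differentiability.\<close>

lemma closed_steady_slice:
  assumes "power_system_ok P"
  shows "closed {(x, u). (x, u, \<omega>\<^sub>0) \<in> steady_set P}"
proof -
  have net: "continuous_on UNIV (\<lambda>(x, u, c). net_field P x u c)"
    using net_field_differentiable
    by (intro continuous_at_imp_continuous_on ballI differentiable_imp_continuous_within)
  have fd: "continuous_on UNIV (\<lambda>x. field_fd x \<omega>\<^sub>0 :: ('a, 'b, 'c) state)"
    using field_fd_differentiable
    by (intro continuous_at_imp_continuous_on ballI differentiable_imp_continuous_within)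
  have v: "continuous_on UNIV (\<lambda>z :: ('a, 'b, 'c) state \<times> 'a input. voltage (fst z))"
    unfolding voltage_def split_beta by (intro continuous_intros)
  have "continuous_on UNIV (\<lambda>z :: ('a, 'b, 'c) state \<times> 'a input. load_current P (voltage (fst z)))"
    by (rule continuous_on_compose2 [OF load_current_continuous [OF assms] v subset_UNIV])
  then have "continuous_on UNIV (\<lambda>z :: ('a, 'b, 'c) state \<times> 'a input.
      (fst z, snd z, load_current P (voltage (fst z))))"
    by (intro continuous_on_Pair continuous_on_fst continuous_on_snd continuous_on_id)
  from continuous_on_compose2 [OF net this subset_UNIV]
  have "continuous_on UNIV (\<lambda>z :: ('a, 'b, 'c) state \<times> 'a input.
      net_field P (fst z) (snd z) (load_current P (voltage (fst z))))"
    by simp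
  moreover have "continuous_on UNIV (\<lambda>z :: ('a, 'b, 'c) state \<times> 'a input. field_fd (fst z) \<omega>\<^sub>0)"
    by (rule continuous_on_compose2 [OF fd continuous_on_fst [OF continuous_on_id] subset_UNIV])
  ultimately have "closed {z. net_field P (fst z) (snd z) (load_current P (voltage (fst z)))
      = field_fd (fst z) \<omega>\<^sub>0}"
    by (rule closed_Collect_eq)
  then show ?thesis
    by (simp add: steady_set_iff field_f_eq_net_field assms case_prod_unfold)
qed

section \<open>Motion in rotating coordinates\<close>

lemma kron_rotation_has_vector_derivative:
  fixes M :: "real \<Rightarrow> real^'n^'n" and y :: "real \<Rightarrow> real^'n^'m"
  assumes M: "\<And>a S. (M has_vector_derivative J ** M a) (at a within S)"
    and y: "(y has_vector_derivative y') (at t within S)"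
    and a: "(\<alpha> has_real_derivative a) (at t within S)"
  shows "((\<lambda>t. kron_mult (mat 1) (M (\<alpha> t)) (y t)) has_vector_derivative
    kron_mult (mat 1) (M (\<alpha> t)) y' + a *\<^sub>R kron_mult (mat 1) J (kron_mult (mat 1) (M (\<alpha> t)) (y t)))
    (at t within S)"
proof -
  have "((\<lambda>t. \<chi> k. M (\<alpha> t) *v (y t $ k)) has_vector_derivative
    (\<chi> k. M (\<alpha> t) *v (y' $ k) + a *\<^sub>R (J *v (M (\<alpha> t) *v (y t $ k))))) (at t within S)"
    by (intro has_vector_derivative_vec_lambda rotation_mult_has_vector_derivative [OF M _ a]
        bounded_linear.has_vector_derivative [OF bounded_linear_vec_nth y])
  then show ?thesis
    by (simp add: kron_mult_mat_1 plus_vec_def scaleR_vec_def)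
qed

text \<open>The velocity splits into the rotated velocity of \<open>x\<close> and the motion of the
  frame; the latter is \<open>field_fd\<close> at the rotated state, as this field generates the
  rotation.\<close>

lemma spin_has_vector_derivative:
  fixes x :: "real \<Rightarrow> ('g::finite, 'v::finite, 't::finite) state"
  assumes x: "(x has_vector_derivative x') (at t within S)"
    and a: "(\<alpha> has_real_derivative a) (at t within S)"
  shows "((\<lambda>t. spin (\<alpha> t) (x t)) has_vector_derivative
    spin_lin (\<alpha> t) x' + field_fd (spin (\<alpha> t) (x t)) a) (at t within S)"
proof -
  note f = bounded_linear.has_vector_derivative [OF bounded_linear_fst]
  note s = bounded_linear.has_vector_derivative [OF bounded_linear_snd]
  note s1 = s [OF x] note s2 = s [OF s1] note s3 = s [OF s2] note s4 = s [OF s3]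
  have "((\<lambda>t. \<chi> k. \<alpha> t) has_vector_derivative ((\<chi> k. a) :: real^'g)) (at t within S)"
    using a by (intro has_vector_derivative_vec_lambda)
      (simp add: has_real_derivative_iff_has_vector_derivative)
  note D = has_vector_derivative_Pair [OF has_vector_derivative_add [OF f [OF x] this]
    has_vector_derivative_Pair [OF f [OF s1]
    has_vector_derivative_Pair [OF kron_rotation_has_vector_derivative [OF Rot5_has_derivative f [OF s2] a]
    has_vector_derivative_Pair [OF kron_rotation_has_vector_derivative [OF Rot_has_derivative f [OF s3] a]
      kron_rotation_has_vector_derivative [OF Rot_has_derivative s4 a]]]]]
  have "a *\<^sub>R (\<chi> k. 1) = ((\<chi> k. a) :: real^'g)"
    by (simp add: vec_eq_iff)
  with D show ?thesis
    by (simp add: spin_def spin_lin_def field_fd_def split_beta)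
qed

lemma field_fd_minus: "field_fd x (- w) = - field_fd x w"
  by (simp add: field_fd_def split: prod.split)

lemma zero_vector_derivative_constant:
  fixes f :: "real \<Rightarrow> 'a::real_normed_vector"
  assumes "\<And>t. t \<in> {a..b} \<Longrightarrow> (f has_vector_derivative 0) (at t within {a..b})"
    and t: "t \<in> {a..b}"
  shows "f t = f a"
proof -
  obtain c where "\<And>t. t \<in> {a..b} \<Longrightarrow> f t = c"
    using has_vector_derivative_zero_constant [OF convex_real_interval(5) assms(1)] by blast
  from this [of t] this [of a] t show ?thesis
    by simp
qed

text \<open>Rotating backwards at speed \<open>w\<close> cancels the velocity, so the state is
  constant in rotating coordinates.\<close>

lemma synchronous_trajectory:
  assumes "\<And>t. t \<in> {a..b} \<Longrightarrow> (x has_vector_derivative field_fd (x t) w) (at t within {a..b})"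
    and t: "t \<in> {a..b}"
  shows "x t = spin (w * (t - a)) (x a)"
proof -
  have "((\<lambda>t. spin (- w * (t - a)) (x t)) has_vector_derivative 0) (at t within {a..b})"
    if "t \<in> {a..b}" for t
  proof -
    have "((\<lambda>t. - w * (t - a)) has_real_derivative - w) (at t within {a..b})"
      by (auto intro!: derivative_eq_intros)
    from spin_has_vector_derivative [OF assms(1) [OF that] this] show ?thesis
      by (simp add: field_fd_spin [symmetric] field_fd_minus)
  qed
  from zero_vector_derivative_constant [OF this t]
  have "spin (- w * (t - a)) (x t) = spin (- w * (a - a)) (x a)" .
  then have "spin (w * (t - a)) (spin (- w * (t - a)) (x t)) = spin (w * (t - a)) (x a)"
    by simp
  then show ?thesis
    by (simp add: spin_spin)
qed

lemma rotating_solution: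
  fixes c :: "real \<Rightarrow> real^2^'m"
  assumes "\<And>t. t \<in> {a..b} \<Longrightarrow>
      (c has_vector_derivative w *\<^sub>R kron_mult (mat 1) j2 (c t)) (at t within {a..b})"
    and t: "t \<in> {a..b}"
  shows "kron_mult (mat 1) (Rot (- w * (t - a))) (c t) = c a"
proof -
  have "((\<lambda>t. kron_mult (mat 1) (Rot (- w * (t - a))) (c t)) has_vector_derivative 0) (at t within {a..b})"
    if "t \<in> {a..b}" for t
  proof -
    have "((\<lambda>t. - w * (t - a)) has_real_derivative - w) (at t within {a..b})"
      by (auto intro!: derivative_eq_intros)
    from kron_rotation_has_vector_derivative [OF Rot_has_derivative assms(1) [OF that] this]
    show ?thesis
      by (simp add: kron_mult_mat_1_linear kron_mult_mat_1_mult Rot_j2)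
  qed
  from zero_vector_derivative_constant [OF this t] show ?thesis
    by (simp add: Rot_0 kron_mult_mat_1)
qed

lemma rotating_has_vector_derivative:
  fixes c\<^sub>0 :: "real^2^'m"
  shows "((\<lambda>t. kron_mult (mat 1) (Rot (w * (t - a))) c\<^sub>0) has_vector_derivative
     w *\<^sub>R kron_mult (mat 1) j2 (kron_mult (mat 1) (Rot (w * (t - a))) c\<^sub>0)) (at t within S)"
proof -
  have "((\<lambda>t. w * (t - a)) has_real_derivative w) (at t within S)"
    by (auto intro!: derivative_eq_intros)
  from kron_rotation_has_vector_derivative [OF Rot_has_derivative has_vector_derivative_const this, of c\<^sub>0]
  show ?thesis
    by (simp add: kron_mult_mat_1_linear)
qed

text \<open>The pivot of both directions. By symmetry the rotated state moves synchronously under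
  the input \<open>u\<close> and the rotated load current; since the velocity determines both, a
  rotated point is steady only with this input and this current.\<close>

lemma steady_set_spin:
  assumes P: "power_system_ok P" and x: "(x, u, \<omega>\<^sub>0) \<in> steady_set P"
  shows "(spin a x, u', \<omega>\<^sub>0) \<in> steady_set P \<longleftrightarrow>
    u' = u \<and> load_current P (voltage (spin a x)) = kron_mult (mat 1) (Rot a) (load_current P (voltage x))"
proof -
  let ?c = "load_current P (voltage x)"
  have "field_fd (spin a x) \<omega>\<^sub>0 = spin_lin a (net_field P x u ?c)"
    using x by (simp add: steady_set_iff field_f_eq_net_field field_fd_spin P)
  also have "\<dots> = net_field P (spin a x) u (kron_mult (mat 1) (Rot a) ?c)"
    by (simp add: net_field_spin)
  finally show ?thesis
    by (simp add: steady_set_iff field_f_eq_net_field net_field_inject P)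
qed

lemma steady_set_continuation:
  fixes z :: "real \<Rightarrow> ('g::finite, 'v::finite, 't::finite) state \<times> 'g input"
  assumes P: "power_system_ok P"
    and cont: "continuous_on {t\<^sub>0..t\<^sub>1} z"
    and z: "(fst (z t\<^sub>0), snd (z t\<^sub>0), \<omega>\<^sub>0) \<in> steady_set P"
    and step: "\<And>s. t\<^sub>0 \<le> s \<Longrightarrow> s < t\<^sub>1 \<Longrightarrow> (fst (z s), snd (z s), \<omega>\<^sub>0) \<in> steady_set P \<Longrightarrow>
      \<exists>d>s. \<forall>t\<in>{s..d}. t \<le> t\<^sub>1 \<longrightarrow> (fst (z t), snd (z t), \<omega>\<^sub>0) \<in> steady_set P"
    and t: "t \<in> {t\<^sub>0..t\<^sub>1}"
  shows "(fst (z t), snd (z t), \<omega>\<^sub>0) \<in> steady_set P"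
proof -
  let ?S = "{(x, u). (x, u, \<omega>\<^sub>0) \<in> steady_set P}"
  have "z t \<in> ?S"
    by (rule closed_continuation [OF cont closed_steady_slice [OF P] _ _ t])
      (use z step in \<open>simp_all add: case_prod_unfold\<close>)
  then show ?thesis
    by (simp add: case_prod_unfold)
qed

section \<open>Trajectories inside the steady set\<close>

lemma closed_loop_trajectory_fst:
  assumes "trajectory (closed_loop P g \<omega>\<^sub>0) t\<^sub>0 t\<^sub>1 z" "t \<in> {t\<^sub>0..t\<^sub>1}"
  shows "((\<lambda>t. fst (z t)) has_vector_derivative field_f P (fst (z t)) (snd (z t))) (at t within {t\<^sub>0..t\<^sub>1})"
proof -
  have "(z has_vector_derivative closed_loop P g \<omega>\<^sub>0 t (z t)) (at t within {t\<^sub>0..t\<^sub>1})"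
    using assms by (simp add: trajectory_def)
  from bounded_linear.has_vector_derivative [OF bounded_linear_fst this] show ?thesis
    by (simp add: closed_loop_def case_prod_unfold)
qed

lemma closed_loop_trajectory_snd:
  assumes "trajectory (closed_loop P g \<omega>\<^sub>0) t\<^sub>0 t\<^sub>1 z" "t \<in> {t\<^sub>0..t\<^sub>1}"
  shows "((\<lambda>t. snd (z t)) has_vector_derivative g t (fst (z t)) (snd (z t)) \<omega>\<^sub>0) (at t within {t\<^sub>0..t\<^sub>1})"
proof -
  have "(z has_vector_derivative closed_loop P g \<omega>\<^sub>0 t (z t)) (at t within {t\<^sub>0..t\<^sub>1})"
    using assms by (simp add: trajectory_def)
  from bounded_linear.has_vector_derivative [OF bounded_linear_snd this] show ?thesis
    by (simp add: closed_loop_def case_prod_unfold)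
qed

lemma steady_trajectory_eq_spin:
  assumes P: "power_system_ok P"
    and x: "\<And>t. t \<in> {a..b} \<Longrightarrow> (x has_vector_derivative field_f P (x t) (u t)) (at t within {a..b})"
    and S: "\<And>t. t \<in> {a..b} \<Longrightarrow> (x t, u t, \<omega>\<^sub>0) \<in> steady_set P"
    and t: "t \<in> {a..b}"
  shows "x t = spin (\<omega>\<^sub>0 * (t - a)) (x a)"
    and "u t = u a"
    and "load_current P (voltage (x t)) =
      kron_mult (mat 1) (Rot (\<omega>\<^sub>0 * (t - a))) (load_current P (voltage (x a)))"
proof -
  show x_eq: "x t = spin (\<omega>\<^sub>0 * (t - a)) (x a)"
  proof (rule synchronous_trajectory [OF _ t])
    \<comment> \<open>On the steady set the two fields coincide, so the motion under
      \<open>field_f\<close> is one under \<open>field_fd\<close>.\<close>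
    fix t assume "t \<in> {a..b}"
    then show "(x has_vector_derivative field_fd (x t) \<omega>\<^sub>0) (at t within {a..b})"
      using x S by (simp add: steady_set_iff [OF P, symmetric]) (metis P steady_set_iff)
  qed
  have "a \<in> {a..b}"
    using t by simp
  from steady_set_spin [OF P S [OF this], of "\<omega>\<^sub>0 * (t - a)" "u t"] S [OF t]
  show "u t = u a" "load_current P (voltage (x t)) =
      kron_mult (mat 1) (Rot (\<omega>\<^sub>0 * (t - a))) (load_current P (voltage (x a)))"
    by (simp_all add: x_eq)
qed

section \<open>Necessity of the two conditions\<close>

lemma invariant_local_trajectory:
  assumes P: "power_system_ok P"
    and wp: "well_posed (closed_loop P g \<omega>\<^sub>0)"
    and inv: "invariant_set (closed_loop P g) (steady_set P)"
    and x\<^sub>0: "(x\<^sub>0, u\<^sub>0, \<omega>\<^sub>0) \<in> steady_set P" and s: "0 < s"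
  obtains t\<^sub>1 z where "trajectory (closed_loop P g \<omega>\<^sub>0) s t\<^sub>1 z" "fst (z s) = x\<^sub>0"
    "\<And>t. t \<in> {s..t\<^sub>1} \<Longrightarrow> snd (z t) = u\<^sub>0"
    "\<And>t. t \<in> {s..t\<^sub>1} \<Longrightarrow> (fst (z t), u\<^sub>0, \<omega>\<^sub>0) \<in> steady_set P"
proof -
  obtain t\<^sub>1 z where z: "trajectory (closed_loop P g \<omega>\<^sub>0) s t\<^sub>1 z" "z s = (x\<^sub>0, u\<^sub>0)"
    using well_posed_exists [OF wp s] .
  have "trajectory (closed_loop P g \<omega>\<^sub>0) s t\<^sub>1 (\<lambda>t. (fst (z t), snd (z t)))"
    using z(1) by simp
  then have S: "(fst (z t), snd (z t), \<omega>\<^sub>0) \<in> steady_set P" if "t \<in> {s..t\<^sub>1}" for t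
    using inv that x\<^sub>0 z(2) unfolding invariant_set_def by fastforce
  \<comment> \<open>A trajectory inside the steady set only rotates its state, which forces its
    input to remain at the initial value.\<close>
  have "snd (z t) = u\<^sub>0" if "t \<in> {s..t\<^sub>1}" for t
    using steady_trajectory_eq_spin(2) [OF P closed_loop_trajectory_fst [OF z(1)] S that] z(2)
    by simp
  with that [OF z(1)] z(2) S show thesis
    by (metis fst_conv)
qed

text \<open>The closed-loop trajectory started at time \<open>s\<close> has constant input, and
  \<open>g s x u \<omega>\<^sub>0\<close> is its one-sided derivative there.\<close>

lemma steady_set_invariant_imp_input_constant:
  assumes "power_system_ok P" "well_posed (closed_loop P g \<omega>\<^sub>0)"
    and "invariant_set (closed_loop P g) (steady_set P)"
    and "(x, u, \<omega>\<^sub>0) \<in> steady_set P" "0 < s"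
  shows "g s x u \<omega>\<^sub>0 = 0"
proof -
  obtain t\<^sub>1 z where z: "trajectory (closed_loop P g \<omega>\<^sub>0) s t\<^sub>1 z" "fst (z s) = x"
    "\<And>t. t \<in> {s..t\<^sub>1} \<Longrightarrow> snd (z t) = u"
    using invariant_local_trajectory [OF assms] by metis
  have s: "s < t\<^sub>1" "s \<in> {s..t\<^sub>1}"
    using z(1) by (auto simp: trajectory_def)
  have "((\<lambda>t. snd (z t)) has_vector_derivative g s x u \<omega>\<^sub>0) (at s within {s..t\<^sub>1})"
    using closed_loop_trajectory_snd [OF z(1) s(2)] z(2) z(3) [OF s(2)] by simp
  moreover have "((\<lambda>t. snd (z t)) has_vector_derivative 0) (at s within {s..t\<^sub>1})"
    by (rule has_vector_derivative_transform [OF s(2) _ has_vector_derivative_const]) (rule z(3))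
  ultimately show ?thesis
    using vector_derivative_unique_within_closed_interval [of s t\<^sub>1 s] s by simp
qed

text \<open>Invariance concerns the closed loop, whereas \<open>\<xi>\<close> has a frozen input.
  Near each steady time the two agree by uniqueness, so \<open>\<xi>\<close> stays steady too and
  hence its load current rotates.\<close>

lemma steady_set_invariant_imp_load_rotates:
  assumes P: "power_system_ok P" and wp: "well_posed (closed_loop P g \<omega>\<^sub>0)"
    and wpu: "well_posed (\<lambda>t x. field_f P x u)"
    and inv: "invariant_set (closed_loop P g) (steady_set P)"
    and x: "(\<xi> t\<^sub>0, u, \<omega>\<^sub>0) \<in> steady_set P"
    and \<xi>: "trajectory (\<lambda>t x. field_f P x u) t\<^sub>0 t\<^sub>1 \<xi>"
    and t: "t \<in> {t\<^sub>0..t\<^sub>1}"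
  shows "((\<lambda>s. load_current P (voltage (\<xi> s))) has_vector_derivative
    \<omega>\<^sub>0 *\<^sub>R kron_mult (mat 1) j2 (load_current P (voltage (\<xi> t)))) (at t within {t\<^sub>0..t\<^sub>1})"
proof -
  have S: "(\<xi> t, u, \<omega>\<^sub>0) \<in> steady_set P" if "t \<in> {t\<^sub>0..t\<^sub>1}" for t
  proof -
    have step: "\<exists>d>s. \<forall>t\<in>{s..d}. t \<le> t\<^sub>1 \<longrightarrow> (\<xi> t, u, \<omega>\<^sub>0) \<in> steady_set P"
      if s: "t\<^sub>0 \<le> s" "s < t\<^sub>1" "(\<xi> s, u, \<omega>\<^sub>0) \<in> steady_set P" for s
    proof -
      have "0 < s"
        using \<xi> s by (auto simp: trajectory_def)
      obtain t\<^sub>2 z where z: "trajectory (closed_loop P g \<omega>\<^sub>0) s t\<^sub>2 z" "fst (z s) = \<xi> s"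
        "\<And>t. t \<in> {s..t\<^sub>2} \<Longrightarrow> snd (z t) = u"
        "\<And>t. t \<in> {s..t\<^sub>2} \<Longrightarrow> (fst (z t), u, \<omega>\<^sub>0) \<in> steady_set P"
        using invariant_local_trajectory [OF P wp inv s(3) \<open>0 < s\<close>] by metis
      have "s < t\<^sub>2"
        using z(1) by (simp add: trajectory_def)
      \<comment> \<open>The closed-loop input stays at \<open>u\<close>, so the state component
        solves the equation with frozen input.\<close>
      have x: "trajectory (\<lambda>t x. field_f P x u) s t\<^sub>2 (\<lambda>t. fst (z t))"
        using closed_loop_trajectory_fst [OF z(1)] z(3) \<open>0 < s\<close> \<open>s < t\<^sub>2\<close>
        by (simp add: trajectory_def)
      define d where "d = min t\<^sub>1 t\<^sub>2"
      have d: "s < d" "d \<le> t\<^sub>1" "d \<le> t\<^sub>2"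
        using \<open>s < t\<^sub>1\<close> \<open>s < t\<^sub>2\<close> by (auto simp: d_def)
      have eq: "fst (z t) = \<xi> t" if "t \<in> {s..d}" for t
        by (rule well_posed_unique [OF wpu trajectory_restrict [OF x order_refl d(1,3)]
            trajectory_restrict [OF \<xi> s(1) d(1,2)] z(2) that])
      have "(\<xi> t, u, \<omega>\<^sub>0) \<in> steady_set P" if "t \<in> {s..d}" for t
        using z(4) [of t] eq [OF that] that d(3) by simp
      then show ?thesis
        using d(1) by blast
    qed
    have "continuous_on {t\<^sub>0..t\<^sub>1} (\<lambda>t. (\<xi> t, u))"
      by (intro continuous_on_Pair trajectory_continuous_on [OF \<xi>] continuous_on_const)
    from steady_set_continuation [OF P this _ _ that, unfolded fst_conv snd_conv, OF x step]
    show ?thesis .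
  qed
  have \<xi>': "(\<xi> has_vector_derivative field_f P (\<xi> t) u) (at t within {t\<^sub>0..t\<^sub>1})"
    if "t \<in> {t\<^sub>0..t\<^sub>1}" for t
    using \<xi> that by (simp add: trajectory_def)
  have rot: "load_current P (voltage (\<xi> t)) =
      kron_mult (mat 1) (Rot (\<omega>\<^sub>0 * (t - t\<^sub>0))) (load_current P (voltage (\<xi> t\<^sub>0)))"
    if "t \<in> {t\<^sub>0..t\<^sub>1}" for t
    by (rule steady_trajectory_eq_spin(3) [OF P \<xi>' S that])
  show ?thesis
    unfolding rot [OF t]
    by (rule has_vector_derivative_transform [OF t rot rotating_has_vector_derivative])
qed

section \<open>Sufficiency of the two conditions\<close>

lemma steady_set_locally_invariant:
  assumes P: "power_system_ok P" and wp: "well_posed (closed_loop P g \<omega>\<^sub>0)"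
    and wpu: "well_posed (\<lambda>t x. field_f P x u)"
    and const: "\<And>t x. 0 < t \<Longrightarrow> (x, u, \<omega>\<^sub>0) \<in> steady_set P \<Longrightarrow> g t x u \<omega>\<^sub>0 = 0"
    and load: "\<And>t\<^sub>1 \<xi> t. trajectory (\<lambda>t x. field_f P x u) s t\<^sub>1 \<xi> \<Longrightarrow> \<xi> s = x\<^sub>0 \<Longrightarrow> t \<in> {s..t\<^sub>1} \<Longrightarrow>
      ((\<lambda>s. load_current P (voltage (\<xi> s))) has_vector_derivative
        \<omega>\<^sub>0 *\<^sub>R kron_mult (mat 1) j2 (load_current P (voltage (\<xi> t)))) (at t within {s..t\<^sub>1})"
    and z: "trajectory (closed_loop P g \<omega>\<^sub>0) s t\<^sub>1 z" "z s = (x\<^sub>0, u)"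
    and x\<^sub>0: "(x\<^sub>0, u, \<omega>\<^sub>0) \<in> steady_set P"
  shows "\<exists>d>s. \<forall>t\<in>{s..d}. t \<le> t\<^sub>1 \<longrightarrow> (fst (z t), snd (z t), \<omega>\<^sub>0) \<in> steady_set P"
proof -
  have s: "0 < s" "s < t\<^sub>1"
    using z(1) by (auto simp: trajectory_def)
  obtain t\<^sub>2 \<xi> where \<xi>: "trajectory (\<lambda>t x. field_f P x u) s t\<^sub>2 \<xi>" "\<xi> s = x\<^sub>0"
    using well_posed_exists [OF wpu s(1)] .
  have t\<^sub>2: "s < t\<^sub>2"
    using \<xi>(1) by (simp add: trajectory_def)
  define c where "c = (\<lambda>t. load_current P (voltage (\<xi> t)))"
  \<comment> \<open>The load condition makes the current constant in coordinates that rotate with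
    it.\<close>
  have rot: "kron_mult (mat 1) (Rot (- \<omega>\<^sub>0 * (t - s))) (c t) = c s" if "t \<in> {s..t\<^sub>2}" for t
    by (rule rotating_solution [OF _ that]) (unfold c_def, rule load [OF \<xi>])
  define y where "y = (\<lambda>t. spin (- \<omega>\<^sub>0 * (t - s)) (\<xi> t))"
  \<comment> \<open>The equation for \<open>y\<close>, with the current frozen at its initial value;
    the load function no longer enters, so the equation is autonomous. The subtracted term is the
    motion of the frame.\<close>
  define F where "F = (\<lambda>x. net_field P x u (c s) - field_fd x \<omega>\<^sub>0)"
  have y: "(y has_vector_derivative F (y t)) (at t within {s..t\<^sub>2})" if t: "t \<in> {s..t\<^sub>2}" for t
  proof -
    have "((\<lambda>t. - \<omega>\<^sub>0 * (t - s)) has_real_derivative - \<omega>\<^sub>0) (at t within {s..t\<^sub>2})"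
      by (auto intro!: derivative_eq_intros)
    moreover have "(\<xi> has_vector_derivative field_f P (\<xi> t) u) (at t within {s..t\<^sub>2})"
      using \<xi>(1) t by (simp add: trajectory_def)
    ultimately have "(y has_vector_derivative
        spin_lin (- \<omega>\<^sub>0 * (t - s)) (field_f P (\<xi> t) u) + field_fd (y t) (- \<omega>\<^sub>0)) (at t within {s..t\<^sub>2})"
      unfolding y_def by (intro spin_has_vector_derivative)
    moreover have "spin_lin (- \<omega>\<^sub>0 * (t - s)) (field_f P (\<xi> t) u) = net_field P (y t) u (c s)"
      unfolding y_def rot [OF t, symmetric] net_field_spin
      by (simp add: field_f_eq_net_field P c_def)
    ultimately show ?thesis
      by (simp add: F_def field_fd_minus)
  qed
  have "(\<lambda>x. net_field P x u (c s)) differentiable (at x\<^sub>0)"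
    using differentiable_compose [OF net_field_differentiable, of "\<lambda>x. (x, u, c s)"] by simp
  then have F: "F differentiable (at x\<^sub>0)"
    unfolding F_def using field_fd_differentiable by (rule differentiable_diff)
  have F0: "F x\<^sub>0 = 0"
    using x\<^sub>0 by (simp add: F_def c_def \<xi>(2) steady_set_iff [OF P] field_f_eq_net_field [OF P])
  have "y s = x\<^sub>0"
    by (simp add: y_def \<xi>(2))
  then obtain d where d: "s < d" "d \<le> t\<^sub>2" "\<And>t. t \<in> {s..d} \<Longrightarrow> y t = x\<^sub>0"
    using stationary_locally [OF F F0 t\<^sub>2 y] by blast
  have S: "(\<xi> t, u, \<omega>\<^sub>0) \<in> steady_set P" if t: "t \<in> {s..d}" for t
  proof -
    have "\<xi> t = spin (\<omega>\<^sub>0 * (t - s)) (y t)"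
      by (simp add: y_def spin_spin)
    then have \<xi>t: "\<xi> t = spin (\<omega>\<^sub>0 * (t - s)) x\<^sub>0"
      using d(3) [OF t] by simp
    have "t \<in> {s..t\<^sub>2}"
      using t d(2) by simp
    \<comment> \<open>Rotating forwards again shows that the load current at the rotated state is
      the rotated initial one, as \<open>steady_set_spin\<close> requires.\<close>
    from arg_cong [OF rot [OF this], of "kron_mult (mat 1) (Rot (\<omega>\<^sub>0 * (t - s)))"]
    have "c t = kron_mult (mat 1) (Rot (\<omega>\<^sub>0 * (t - s))) (c s)"
      by (simp add: kron_mult_mat_1_mult Rot_mult) (simp add: Rot_0 kron_mult_mat_1)
    then show ?thesis
      by (simp add: \<xi>t steady_set_spin [OF P x\<^sub>0] c_def \<xi>(2))
  qed
  define e where "e = min d t\<^sub>1"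
  have e: "s < e" "e \<le> d" "e \<le> t\<^sub>1"
    using d(1) s(2) by (auto simp: e_def)
  have "trajectory (\<lambda>t x. field_f P x u) s e \<xi>"
    by (rule trajectory_restrict [OF \<xi>(1)]) (use e d in auto)
  \<comment> \<open>Condition (i) along the steady states \<open>\<xi> t\<close> makes the constant
    input solve the controller equation, so uniqueness for the closed loop can identify this pair
    with \<open>z\<close>.\<close>
  then have "trajectory (closed_loop P g \<omega>\<^sub>0) s e (\<lambda>t. (\<xi> t, u))"
    unfolding trajectory_def closed_loop_def
    using const S e(2) by (auto intro!: has_vector_derivative_Pair has_vector_derivative_eq_rhs
        [OF has_vector_derivative_const])
  moreover have "trajectory (closed_loop P g \<omega>\<^sub>0) s e z"
    by (rule trajectory_restrict [OF z(1) order_refl e(1,3)])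
  ultimately have "z t = (\<xi> t, u)" if "t \<in> {s..e}" for t
    using well_posed_unique [OF wp _ _ _ that] z(2) \<xi>(2) by metis
  then show ?thesis
    using S e by (intro exI [of _ e]) auto
qed

theorem theorem2:
  fixes P :: "('g::finite, 'v::finite, 't::finite) power_system"
    and g :: "real \<Rightarrow> ('g, 'v, 't) state \<Rightarrow> 'g input \<Rightarrow> real \<Rightarrow> 'g input"
  assumes "power_system_ok P"
    and "\<And>\<omega>\<^sub>0. well_posed (closed_loop P g \<omega>\<^sub>0)"
    and "\<And>u. well_posed (\<lambda>t x. field_f P x u)"
  shows "invariant_set (closed_loop P g) (steady_set P) \<longleftrightarrow>
     (\<forall>t > 0. \<forall>(x, u, \<omega>\<^sub>0) \<in> steady_set P. g t x u \<omega>\<^sub>0 = 0) \<and>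
     (\<forall>(x, u, \<omega>\<^sub>0) \<in> steady_set P. \<forall>t\<^sub>0 t\<^sub>1 \<xi>.
        trajectory (\<lambda>t x. field_f P x u) t\<^sub>0 t\<^sub>1 \<xi> \<longrightarrow> \<xi> t\<^sub>0 = x \<longrightarrow>
        (\<forall>t\<in>{t\<^sub>0..t\<^sub>1}.
           ((\<lambda>s. load_current P (voltage (\<xi> s))) has_vector_derivative
              \<omega>\<^sub>0 *\<^sub>R kron_mult (mat 1) j2 (load_current P (voltage (\<xi> t)))) (at t within {t\<^sub>0..t\<^sub>1})))"
    (is "?inv \<longleftrightarrow> ?const \<and> ?load")
proof (intro iffI conjI)
  assume inv: ?inv
  show ?const
    using steady_set_invariant_imp_input_constant [OF assms(1,2) inv] by blast
  show ?load
    using steady_set_invariant_imp_load_rotates [OF assms inv] by blast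
next
  assume "?const \<and> ?load"
  then have const: ?const and load: ?load
    by blast+
  \<comment> \<open>The load condition is used with start time \<open>s\<close> and frozen input
    \<open>snd (z s)\<close>, so it applies anew at every steady time of the closed-loop
    trajectory.\<close>
  have step: "\<exists>d>s. \<forall>t\<in>{s..d}. t \<le> t\<^sub>1 \<longrightarrow> (fst (z t), snd (z t), \<omega>\<^sub>0) \<in> steady_set P"
    if z: "trajectory (closed_loop P g \<omega>\<^sub>0) s t\<^sub>1 z"
      and S: "(fst (z s), snd (z s), \<omega>\<^sub>0) \<in> steady_set P" for \<omega>\<^sub>0 s t\<^sub>1 z
    by (rule steady_set_locally_invariant [OF assms(1-3) _ _ z _ S])
      (use const load S in \<open>fastforce+\<close>)
  show ?inv
    unfolding invariant_set_def
  proof (intro allI impI ballI)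
    fix \<omega>\<^sub>0 t\<^sub>0 t\<^sub>1 x u t
    assume z: "trajectory (closed_loop P g \<omega>\<^sub>0) t\<^sub>0 t\<^sub>1 (\<lambda>t. (x t, u t))"
      and S: "(x t\<^sub>0, u t\<^sub>0, \<omega>\<^sub>0) \<in> steady_set P" and t: "t \<in> {t\<^sub>0..t\<^sub>1}"
    have "(fst (x t, u t), snd (x t, u t), \<omega>\<^sub>0) \<in> steady_set P"
    proof (rule steady_set_continuation [OF assms(1) trajectory_continuous_on [OF z] _ _ t])
      fix s assume s: "t\<^sub>0 \<le> s" "s < t\<^sub>1" "(fst (x s, u s), snd (x s, u s), \<omega>\<^sub>0) \<in> steady_set P"
      show "\<exists>d>s. \<forall>t\<in>{s..d}. t \<le> t\<^sub>1 \<longrightarrow> (fst (x t, u t), snd (x t, u t), \<omega>\<^sub>0) \<in> steady_set P"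
        using trajectory_restrict [OF z s(1,2) order_refl] s(3) by (rule step)
    qed (use S in simp)
    then show "(x t, u t, \<omega>\<^sub>0) \<in> steady_set P"
      by simp
  qed
qed

end
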